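(* There is a universal constant $c_0>0$ such that, for any $L_f,\Delta>0$, $\kappa_A\ge1$, any first-order linear span algorithm (class $\mathcal A$) and any $0<\epsilon\le c_0\sqrt{L_f\Delta}$, there exists a problem instance in $\mathcal F_{\mathrm{NC}}(L_f,\Delta,\kappa_A)$ such that at least $$\Omega\left(\frac{\kappa_AL_f\Delta}{\epsilon^2}\right)$$ iterations are required in order to find an iterate $x_k$ satisfying $\mathrm{SubOpt}_{\mathsf{NC}}(x_k)\le\epsilon$.
   Context: $\Omega(\cdot)$ hides a universal positive constant. The constant $c_0$ is the universal constant in the paper's lower bound: for every integer $k\ge\kappa_A$ there is an instance in $\mathcal F_{\mathrm{NC}}(L_f,\Delta,\kappa_A)$ on which every first-order linear span algorithm has $\mathrm{SubOpt}_{\mathsf{NC}}(x_k)\ge c_0\sqrt{\kappa_AL_f\Delta/k}$. Class $\mathcal F_{\mathrm{NC}}(L_f,\Delta,\kappa_A)$: problems $\min_xF(x)=f(x)+h(Ax-b)$ of arbitrary dimension ($h$ proper closed convex; constraints $Ax=b$ correspond to $h=\mathbb I_{\{0\}}$, the indicator function of $\{0\}$) with $f$ $L_f$-smooth, $x_0\in\mathrm{dom}\,F$, $F(x_0)-\inf_xF(x)\le\Delta$, and condition number of $A$ (norm over minimal singular value) at most $\kappa_A$. $\mathrm{SubOpt}_{\mathsf{NC}}(x):=L_f\left\|x-\mathrm{prox}_{\frac1{2L_f}h(A\cdot-b)}\left(x-\frac1{2L_f}\nabla f(x)\right)\right\|$ with $\mathrm{prox}_g(x)=\arg\min_u\{g(u)+\frac12\|x-u\|^2\}$;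 for linear equality constraints the prox is the projection onto $\{x:Ax=b\}$. First-order linear span algorithm (class $\mathcal A$): with $x_0=0,\lambda_0=0$, $\mathcal S_0^x=\mathrm{Span}\{x_0\}$, $\mathcal S_0^\lambda=\mathrm{Span}\{\lambda_0\}$, the iterates satisfy $(x_k,\lambda_k)\in\mathcal S^x_k\times\mathcal S^\lambda_k$, where $$\mathcal S^x_{k+1}=\mathrm{Span}\{x_i,\nabla f(\hat x_i),A^{\mathrm T}\hat\lambda_i:\ \hat x_i\in\mathcal S^x_i,\hat\lambda_i\in\mathcal S^\lambda_i,0\le i\le k\},$$ $$\mathcal S^\lambda_{k+1}=\mathrm{Span}\{\lambda_i,\mathrm{prox}_{\eta_ih^\star}(\hat\lambda_i+\eta_i(A\hat x_i-b)):\ \hat x_i\in\mathcal S^x_i,\hat\lambda_i\in\mathcal S^\lambda_i,0\le i\le k\},$$ with step sizes $\eta_i>0$ and $h^\star$ the convex conjugate. For linear equality constrained problems the class is taken to be: $x_{k+1}\in\mathcal S^x_{k+1}=\mathrm{Span}\{x_i,\nabla f(\hat x_i),A^{\mathrm T}(A\hat x_i-b):\hat x_i\in\mathcal S_i^x,0\le i\le k\}$. *)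

theory Defs
  imports
    "HOL-Library.Extended_Real"
    "Jordan_Normal_Form.Spectral_Radius"
    "Jordan_Normal_Form.VS_Connect"
begin

text \<open>
  Problems of varying dimension are quantified over inside formulas, so points of the
  \<open>n\<close>-dimensional Euclidean space are elements of \<open>carrier_vec n\<close>. Functions on that space
  are only ever inspected on the carrier; their values elsewhere are irrelevant.
\<close>

abbreviation vspan :: "nat \<Rightarrow> real vec set \<Rightarrow> real vec set" where
  "vspan n S \<equiv> LinearCombinations.module.span class_ring (module_vec TYPE(real) n) S"

definition vnorm :: "real vec \<Rightarrow> real" where
  "vnorm v = sqrt (v \<bullet> v)"

definition has_gradient :: "nat \<Rightarrow> (real vec \<Rightarrow> real) \<Rightarrow> real vec \<Rightarrow> real vec \<Rightarrow> bool" where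
  "has_gradient n f x g \<longleftrightarrow> g \<in> carrier_vec n \<and>
     (\<forall>e>0. \<exists>d>0. \<forall>y\<in>carrier_vec n. vnorm (y - x) < d \<longrightarrow>
        \<bar>f y - f x - g \<bullet> (y - x)\<bar> \<le> e * vnorm (y - x))"

definition gradient :: "nat \<Rightarrow> (real vec \<Rightarrow> real) \<Rightarrow> real vec \<Rightarrow> real vec" where
  "gradient n f x = (THE g. has_gradient n f x g)"

definition smooth :: "nat \<Rightarrow> real \<Rightarrow> (real vec \<Rightarrow> real) \<Rightarrow> bool" where
  "smooth n L f \<longleftrightarrow>
     (\<forall>x\<in>carrier_vec n. \<exists>g. has_gradient n f x g) \<and>
     (\<forall>x\<in>carrier_vec n. \<forall>y\<in>carrier_vec n.
        vnorm (gradient n f x - gradient n f y) \<le> L * vnorm (x - y))"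

definition proper_fun :: "nat \<Rightarrow> (real vec \<Rightarrow> ereal) \<Rightarrow> bool" where
  "proper_fun m h \<longleftrightarrow>
     (\<forall>y\<in>carrier_vec m. h y \<noteq> -\<infinity>) \<and> (\<exists>y\<in>carrier_vec m. h y \<noteq> \<infinity>)"

text \<open>Closedness is rendered as lower semicontinuity.\<close>

definition closed_fun :: "nat \<Rightarrow> (real vec \<Rightarrow> ereal) \<Rightarrow> bool" where
  "closed_fun m h \<longleftrightarrow>
     (\<forall>x\<in>carrier_vec m. \<forall>c. c < h x \<longrightarrow>
        (\<exists>d>0. \<forall>y\<in>carrier_vec m. vnorm (y - x) < d \<longrightarrow> c < h y))"

definition convex_fun :: "nat \<Rightarrow> (real vec \<Rightarrow> ereal) \<Rightarrow> bool" where
  "convex_fun m h \<longleftrightarrow>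
     (\<forall>x\<in>carrier_vec m. \<forall>y\<in>carrier_vec m. \<forall>t. 0 < t \<and> t < 1 \<longrightarrow>
        h ((1 - t) \<cdot>\<^sub>v x + t \<cdot>\<^sub>v y) \<le> ereal (1 - t) * h x + ereal t * h y)"

definition conjugate_fun :: "nat \<Rightarrow> (real vec \<Rightarrow> ereal) \<Rightarrow> real vec \<Rightarrow> ereal" where
  "conjugate_fun m h l = (SUP y\<in>carrier_vec m. ereal (l \<bullet> y) - h y)"

text \<open>The minimiser exists and is unique whenever \<open>g\<close> is proper, closed and convex.\<close>

definition prox :: "nat \<Rightarrow> (real vec \<Rightarrow> ereal) \<Rightarrow> real vec \<Rightarrow> real vec" where
  "prox n g x =
     arg_min (\<lambda>u. g u + ereal ((vnorm (x - u))\<^sup>2 / 2)) (\<lambda>u. u \<in> carrier_vec n)"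

definition op_norm :: "real mat \<Rightarrow> real" where
  "op_norm A = (SUP v\<in>{v \<in> carrier_vec (dim_col A). vnorm v \<le> 1}. vnorm (A *\<^sub>v v))"

text \<open>
  The smaller Gram matrix is used, so that an \<open>m \<times> n\<close> matrix has \<open>min m n\<close> singular
  values (with multiplicity), without the spurious zeros of the larger Gram matrix.
\<close>

definition singular_values :: "real mat \<Rightarrow> real set" where
  "singular_values A =
     sqrt ` spectrum (if dim_row A \<le> dim_col A then A * transpose_mat A else transpose_mat A * A)"

definition min_singular_value :: "real mat \<Rightarrow> real" where
  "min_singular_value A = Min (singular_values A)"

text \<open>Positivity is required explicitly because division by zero yields zero.\<close>

definition condition_number_le :: "real mat \<Rightarrow> real \<Rightarrow> bool" where
  "condition_number_le A \<kappa> \<longleftrightarrow>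
     0 < min_singular_value A \<and> op_norm A / min_singular_value A \<le> \<kappa>"

text \<open>The problem of minimising \<open>f x + h (A x - b)\<close> over \<open>x\<close> of dimension \<open>xdim\<close>.\<close>

record problem =
  xdim :: nat
  ydim :: nat
  fobj :: "real vec \<Rightarrow> real"
  hobj :: "real vec \<Rightarrow> ereal"
  Amat :: "real mat"
  bvec :: "real vec"

definition well_formed :: "problem \<Rightarrow> bool" where
  "well_formed P \<longleftrightarrow>
     0 < xdim P \<and> 0 < ydim P \<and>
     Amat P \<in> carrier_mat (ydim P) (xdim P) \<and> bvec P \<in> carrier_vec (ydim P) \<and>
     (\<exists>L>0. smooth (xdim P) L (fobj P)) \<and>
     proper_fun (ydim P) (hobj P) \<and> closed_fun (ydim P) (hobj P) \<and>
     convex_fun (ydim P) (hobj P)"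

definition residual :: "problem \<Rightarrow> real vec \<Rightarrow> real vec" where
  "residual P x = Amat P *\<^sub>v x - bvec P"

definition total_obj :: "problem \<Rightarrow> real vec \<Rightarrow> ereal" where
  "total_obj P x = ereal (fobj P x) + hobj P (residual P x)"

definition linear_equality_constrained :: "problem \<Rightarrow> bool" where
  "linear_equality_constrained P \<longleftrightarrow>
     (\<forall>y\<in>carrier_vec (ydim P). hobj P y = (if y = 0\<^sub>v (ydim P) then 0 else \<infinity>))"

text \<open>The initial point of every problem is the origin.\<close>

definition F_NC :: "real \<Rightarrow> real \<Rightarrow> real \<Rightarrow> problem set" where
  "F_NC L\<^sub>f \<Delta> \<kappa> = {P. well_formed P \<and>
     smooth (xdim P) L\<^sub>f (fobj P) \<and>
     total_obj P (0\<^sub>v (xdim P)) < \<infinity> \<and>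
     total_obj P (0\<^sub>v (xdim P)) - (INF x\<in>carrier_vec (xdim P). total_obj P x) \<le> ereal \<Delta> \<and>
     condition_number_le (Amat P) \<kappa>}"

definition SubOpt_NC :: "real \<Rightarrow> problem \<Rightarrow> real vec \<Rightarrow> real" where
  "SubOpt_NC L\<^sub>f P x =
     L\<^sub>f * vnorm (x - prox (xdim P)
       (\<lambda>u. ereal (1 / (2 * L\<^sub>f)) * hobj P (residual P u))
       (x - (1 / (2 * L\<^sub>f)) \<cdot>\<^sub>v gradient (xdim P) (fobj P) x))"

text \<open>
  The equations for \<open>Sx\<close> and \<open>Sl\<close> determine these sequences of subspaces uniquely
  from the iterates \<open>x\<close>, \<open>l\<close> and the step sizes \<open>\<eta>\<close>.
\<close>

definition composite_span_run :: "problem \<Rightarrow> (nat \<Rightarrow> real vec) \<Rightarrow> (nat \<Rightarrow> real vec) \<Rightarrow> bool" where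
  "composite_span_run P x l \<longleftrightarrow>
     x 0 = 0\<^sub>v (xdim P) \<and> l 0 = 0\<^sub>v (ydim P) \<and>
     (\<exists>\<eta> Sx Sl.
        (\<forall>i. 0 < \<eta> i) \<and>
        Sx 0 = vspan (xdim P) {x 0} \<and> Sl 0 = vspan (ydim P) {l 0} \<and>
        (\<forall>k. Sx (Suc k) = vspan (xdim P)
               ({x i | i. i \<le> k}
                \<union> {gradient (xdim P) (fobj P) u | i u. i \<le> k \<and> u \<in> Sx i}
                \<union> {transpose_mat (Amat P) *\<^sub>v v | i v. i \<le> k \<and> v \<in> Sl i})) \<and>
        (\<forall>k. Sl (Suc k) = vspan (ydim P)
               ({l i | i. i \<le> k}
                \<union> {prox (ydim P) (\<lambda>w. ereal (\<eta> i) * conjugate_fun (ydim P) (hobj P) w)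
                     (v + \<eta> i \<cdot>\<^sub>v residual P u) | i u v. i \<le> k \<and> u \<in> Sx i \<and> v \<in> Sl i})) \<and>
        (\<forall>k. x k \<in> Sx k \<and> l k \<in> Sl k))"

definition equality_span_run :: "problem \<Rightarrow> (nat \<Rightarrow> real vec) \<Rightarrow> bool" where
  "equality_span_run P x \<longleftrightarrow>
     x 0 = 0\<^sub>v (xdim P) \<and>
     (\<exists>Sx.
        Sx 0 = vspan (xdim P) {x 0} \<and>
        (\<forall>k. Sx (Suc k) = vspan (xdim P)
               ({x i | i. i \<le> k}
                \<union> {gradient (xdim P) (fobj P) u | i u. i \<le> k \<and> u \<in> Sx i}
                \<union> {transpose_mat (Amat P) *\<^sub>v residual P u | i u. i \<le> k \<and> u \<in> Sx i})) \<and>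
        (\<forall>k. x k \<in> Sx k))"

text \<open>
  An algorithm maps every problem to its sequence of primal-dual iterates. On linear equality
  constrained problems only the purely primal span condition is imposed; there the primal
  iterates of a composite run satisfy it too, so that this is the larger class.
\<close>

type_synonym algorithm = "problem \<Rightarrow> nat \<Rightarrow> real vec \<times> real vec"

definition first_order_linear_span :: "algorithm \<Rightarrow> bool" where
  "first_order_linear_span alg \<longleftrightarrow>
     (\<forall>P. well_formed P \<longrightarrow>
        (if linear_equality_constrained P
         then equality_span_run P (\<lambda>k. fst (alg P k))
         else composite_span_run P (\<lambda>k. fst (alg P k)) (\<lambda>k. snd (alg P k))))"

end

theory Submission
  imports Defs
begin

text \<open>
  The hard instances are linearly constrained nonconvex chains. The variables \<open>y\<^sub>0, \<dots>, y\<^sub>T\<^sub>-\<^sub>1\<close> of a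
  nonconvex zero-chain, whose gradient stays bounded away from zero as long as the last variable
  is small, are each replaced by a block of \<open>m\<close> copies, which \<open>A x = 0\<close> ties together along a
  path. The link between \<open>y\<^sub>i\<^sub>-\<^sub>1\<close> and \<open>y\<^sub>i\<close> reads the last copy of the former and the first
  copy of the latter, so that gradients carry information across block boundaries only and
  \<open>A\<^sup>T A\<close> carries it one step along a path. Every iteration thus reaches at most one further
  coordinate, and \<open>T m\<close> iterations are needed before the last coordinate is nonzero. The path has
  condition number of order \<open>m\<close>, and \<open>T\<close> can be taken of order \<open>L\<^sub>f \<Delta> / \<epsilon>\<^sup>2\<close>.
\<close>

section \<open>The link function\<close>

text \<open>The instance depends on the parameters alone, not on the algorithm. The objective gap
  counts links, so it grows with \<open>T\<close> but not with \<open>m\<close>: longer blocks delay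
  the algorithm at no cost in the gap and are limited only by the condition number. This is the
  source of the factor \<kappa>. The obstacle is the suboptimality measure. Iterates may be
  infeasible, and the prox step projects the gradient onto the kernel of \<open>A\<close>, so a
  large gradient entry could be cancelled by other entries or diluted over the copies in its block.
  Cancellation is excluded by giving all partial derivatives the same sign, dilution by a kernel
  vector of bounded norm with weight 1 where links attach. An infeasible point with small measure is
  still close to the kernel, so the two ends of each block nearly agree and the chain argument
  survives. Since only a Lipschitz gradient is demanded, piecewise quadratic links suffice.\<close>

definition ramp_sq :: "real \<Rightarrow> real" where
  "ramp_sq z = (max z 0)\<^sup>2 / 2"

definition tent :: "real \<Rightarrow> real" where
  "tent z = max z 0 - 2 * max (z - 1) 0 + max (z - 2) 0"

text \<open>A continuously differentiable step, 0 up to 0 and 1 from 2 on, with derivative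
  \<open>tent\<close>. Writing it as a second difference of \<open>ramp_sq\<close> lets the Taylor
  bound for \<open>ramp_sq\<close> carry over.\<close>

definition smooth_step :: "real \<Rightarrow> real" where
  "smooth_step z = ramp_sq z - 2 * ramp_sq (z - 1) + ramp_sq (z - 2)"

text \<open>The derivative \<open>max x 0\<close> is 1-Lipschitz. Instead of integrating it, each
  sign pattern is checked: the remainder is always \<open>e / 2\<close> with \<open>e\<close>
  between 0 and the squared increment.\<close>

lemma ramp_sq_remainder: "\<bar>ramp_sq y - ramp_sq x - max x 0 * (y - x)\<bar> \<le> (y - x)\<^sup>2 / 2"
proof -
  have *: "\<bar>ramp_sq y - ramp_sq x - max x 0 * (y - x)\<bar> \<le> (y - x)\<^sup>2 / 2" if "0 \<le> e" "e \<le> (y - x)\<^sup>2"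
    "ramp_sq y - ramp_sq x - max x 0 * (y - x) = e / 2" for e
    using that by simp
  have xx: "0 \<le> x * x" "0 \<le> y * y" by simp_all
  consider "0 \<le> x" "0 \<le> y" | "0 \<le> x" "y < 0" | "x < 0" "0 \<le> y" | "x < 0" "y < 0"
    by linarith
  then show ?thesis
  proof cases
    case 1
    then have "ramp_sq y - ramp_sq x - max x 0 * (y - x) = (y - x)\<^sup>2 / 2"
      by (simp add: ramp_sq_def power2_eq_square algebra_simps diff_divide_distrib add_divide_distrib)
    then show ?thesis
      by (intro *[of "(y - x)\<^sup>2"]) simp_all
  next
    case 2
    then have "x * y \<le> 0"
      by (simp add: mult_nonneg_nonpos)
    then have "0 \<le> x * x - 2 * (x * y)" "x * x - 2 * (x * y) \<le> (y - x)\<^sup>2"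
      using xx by (linarith, simp add: power2_eq_square algebra_simps)
    moreover have "ramp_sq y - ramp_sq x - max x 0 * (y - x) = (x * x - 2 * (x * y)) / 2"
      using 2 by (simp add: ramp_sq_def power2_eq_square algebra_simps diff_divide_distrib)
    ultimately show ?thesis
      by (rule *)
  next
    case 3
    then have "x * y \<le> 0"
      by (simp add: mult_nonpos_nonneg)
    with 3 xx show ?thesis
      by (intro *[of "y * y"])
        (simp_all add: ramp_sq_def power2_eq_square algebra_simps)
  next
    case 4
    then show ?thesis
      by (intro *[of 0]) (simp_all add: ramp_sq_def)
  qed
qed

lemma tent_bounds: "0 \<le> tent z" "tent z \<le> 1"
  by (auto simp: tent_def max_def)

lemma tent_lipschitz: "\<bar>tent x - tent y\<bar> \<le> \<bar>x - y\<bar>"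
  by (simp add: tent_def max_def abs_if)

lemma smooth_step_eq:
  "smooth_step z = (if z \<le> 0 then 0 else if z \<le> 1 then z\<^sup>2 / 2 else if z \<le> 2 then 1 - (2 - z)\<^sup>2 / 2 else 1)"
  by (auto simp: smooth_step_def ramp_sq_def max_def power2_eq_square field_simps)

lemma smooth_step_bounds: "0 \<le> smooth_step z" "smooth_step z \<le> 1"
proof -
  have *: "u\<^sup>2 \<le> 1" if "0 \<le> u" "u \<le> 1" for u :: real
    using that by (simp add: power_le_one)
  show "0 \<le> smooth_step z" "smooth_step z \<le> 1"
    using *[of z] *[of "2 - z"] by (auto simp: smooth_step_eq)
qed

text \<open>Three remainders of at most half the squared increment, with coefficients 1, 2, 1 in
  absolute value, give the factor 2.\<close>

lemma smooth_step_remainder: "\<bar>smooth_step y - smooth_step x - tent x * (y - x)\<bar> \<le> 2 * (y - x)\<^sup>2"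
proof -
  define r where "r t = ramp_sq (y - t) - ramp_sq (x - t) - max (x - t) 0 * ((y - t) - (x - t))" for t
  have "\<bar>r t\<bar> \<le> (y - x)\<^sup>2 / 2" for t
    using ramp_sq_remainder[of "y - t" "x - t"] by (simp add: r_def)
  from this[of 0] this[of 1] this[of 2]
  have "\<bar>r 0 - 2 * r 1 + r 2\<bar> \<le> 2 * (y - x)\<^sup>2" by linarith
  moreover have "r 0 - 2 * r 1 + r 2 = smooth_step y - smooth_step x - tent x * (y - x)"
    by (simp add: smooth_step_def tent_def r_def algebra_simps)
  ultimately show ?thesis by simp
qed

text \<open>For increments up to 1 the linear term contributes 1 and the remainder 2; for larger
  ones the range [0, 1] is enough. The constant is not sharp.\<close>

lemma smooth_step_lipschitz: "\<bar>smooth_step y - smooth_step x\<bar> \<le> 3 * \<bar>y - x\<bar>"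
proof (cases "\<bar>y - x\<bar> \<le> 1")
  case True
  have "\<bar>tent x * (y - x)\<bar> \<le> \<bar>y - x\<bar>"
    using tent_bounds[of x] by (simp add: abs_mult mult_left_le_one_le)
  moreover have "(y - x)\<^sup>2 \<le> \<bar>y - x\<bar>"
    using mult_right_mono[OF True, of "\<bar>y - x\<bar>"] by (simp add: power2_eq_square)
  ultimately show ?thesis
    using smooth_step_remainder[of y x] by argo
next
  case False
  then show ?thesis
    using smooth_step_bounds[of x] smooth_step_bounds[of y] by argo
qed

text \<open>
  The term \<open>ramp_sq (- a)\<close> makes \<open>link_snd b\<close> strictly negative also far out on the negative axis,
  where \<open>tent (a + 1)\<close> vanishes. Both partial derivatives are nonpositive, so that contributions
  of neighbouring links never cancel.
\<close>

definition link :: "real \<Rightarrow> real \<Rightarrow> real" where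
  "link b a = ramp_sq (- a) - smooth_step b * smooth_step (a + 1)"

definition link_fst :: "real \<Rightarrow> real \<Rightarrow> real" where
  "link_fst b a = - (tent b * smooth_step (a + 1))"

definition link_snd :: "real \<Rightarrow> real \<Rightarrow> real" where
  "link_snd b a = - max (- a) 0 - smooth_step b * tent (a + 1)"

text \<open>The increment of a product \<open>p q\<close> is \<open>p dq + q dp + dp dq\<close>. The
  first two terms are Taylor expansions with bounded factors; the mixed term is at most 3 * 3 times
  a product of increments, hence 9/2 times the sum of their squares. The worse coordinate collects
  1/2 + 2 + 9/2 = 7.\<close>

lemma link_remainder:
  "\<bar>link b' a' - link b a - link_fst b a * (b' - b) - link_snd b a * (a' - a)\<bar>
   \<le> 7 * ((b' - b)\<^sup>2 + (a' - a)\<^sup>2)"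
proof -
  define rb where "rb = smooth_step b' - smooth_step b - tent b * (b' - b)"
  define ra where "ra = smooth_step (a' + 1) - smooth_step (a + 1) - tent (a + 1) * (a' - a)"
  define rq where "rq = ramp_sq (- a') - ramp_sq (- a) - max (- a) 0 * (- a' - - a)"
  define db where "db = smooth_step b' - smooth_step b"
  define da where "da = smooth_step (a' + 1) - smooth_step (a + 1)"
  have eq: "link b' a' - link b a - link_fst b a * (b' - b) - link_snd b a * (a' - a)
      = rq - (smooth_step b * ra + smooth_step (a + 1) * rb + db * da)"
    by (simp add: link_def link_fst_def link_snd_def rb_def ra_def rq_def db_def da_def algebra_simps)
  have "\<bar>rq\<bar> \<le> (a' - a)\<^sup>2 / 2"
    using ramp_sq_remainder[of "- a'" "- a"] by (simp add: rq_def power2_commute)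
  moreover have "\<bar>smooth_step b * ra\<bar> \<le> 2 * (a' - a)\<^sup>2"
  proof -
    have "\<bar>smooth_step b * ra\<bar> \<le> 1 * \<bar>ra\<bar>"
      unfolding abs_mult using smooth_step_bounds[of b] by (intro mult_right_mono) auto
    then show ?thesis
      using smooth_step_remainder[of "a' + 1" "a + 1"] by (simp add: ra_def)
  qed
  moreover have "\<bar>smooth_step (a + 1) * rb\<bar> \<le> 2 * (b' - b)\<^sup>2"
  proof -
    have "\<bar>smooth_step (a + 1) * rb\<bar> \<le> 1 * \<bar>rb\<bar>"
      unfolding abs_mult using smooth_step_bounds[of "a + 1"] by (intro mult_right_mono) auto
    then show ?thesis
      using smooth_step_remainder[of b' b] by (simp add: rb_def)
  qed
  moreover have "\<bar>db * da\<bar> \<le> 9 / 2 * ((b' - b)\<^sup>2 + (a' - a)\<^sup>2)"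
  proof -
    have "\<bar>db * da\<bar> \<le> (3 * \<bar>b' - b\<bar>) * (3 * \<bar>a' - a\<bar>)"
      unfolding abs_mult db_def da_def
      using smooth_step_lipschitz[of b' b] smooth_step_lipschitz[of "a' + 1" "a + 1"]
      by (intro mult_mono) auto
    also have "\<dots> \<le> 9 / 2 * (\<bar>b' - b\<bar>\<^sup>2 + \<bar>a' - a\<bar>\<^sup>2)"
      using sum_squares_bound[of "\<bar>b' - b\<bar>" "\<bar>a' - a\<bar>"] by simp
    finally show ?thesis by simp
  qed
  ultimately show ?thesis
    using zero_le_power2[of "a' - a"] zero_le_power2[of "b' - b"]
    unfolding eq by argo
qed

lemma abs_mult_diff_le:
  fixes p q r s :: real
  assumes "\<bar>p\<bar> \<le> 1" "\<bar>s\<bar> \<le> 1"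
  shows "\<bar>p * q - r * s\<bar> \<le> \<bar>q - s\<bar> + \<bar>p - r\<bar>"
proof -
  have "p * q - r * s = p * (q - s) + s * (p - r)"
    by (simp add: algebra_simps)
  also have "\<bar>\<dots>\<bar> \<le> \<bar>p\<bar> * \<bar>q - s\<bar> + \<bar>s\<bar> * \<bar>p - r\<bar>"
    by (metis abs_mult abs_triangle_ineq)
  also have "\<dots> \<le> 1 * \<bar>q - s\<bar> + 1 * \<bar>p - r\<bar>"
    using assms by (intro add_mono mult_right_mono) auto
  finally show ?thesis by simp
qed

lemma link_fst_lipschitz:
  "\<bar>link_fst b' a' - link_fst b a\<bar> \<le> 3 * (\<bar>b' - b\<bar> + \<bar>a' - a\<bar>)"
proof -
  have "\<bar>tent b' * smooth_step (a' + 1) - tent b * smooth_step (a + 1)\<bar>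
      \<le> \<bar>smooth_step (a' + 1) - smooth_step (a + 1)\<bar> + \<bar>tent b' - tent b\<bar>"
    using tent_bounds[of b'] smooth_step_bounds[of "a + 1"] by (intro abs_mult_diff_le) auto
  then show ?thesis
    using smooth_step_lipschitz[of "a' + 1" "a + 1"] tent_lipschitz[of b' b]
    unfolding link_fst_def by argo
qed

lemma link_snd_lipschitz:
  "\<bar>link_snd b' a' - link_snd b a\<bar> \<le> 3 * (\<bar>b' - b\<bar> + \<bar>a' - a\<bar>)"
proof -
  have "\<bar>smooth_step b' * tent (a' + 1) - smooth_step b * tent (a + 1)\<bar>
      \<le> \<bar>tent (a' + 1) - tent (a + 1)\<bar> + \<bar>smooth_step b' - smooth_step b\<bar>"
    using smooth_step_bounds[of b'] tent_bounds[of "a + 1"] by (intro abs_mult_diff_le) auto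
  moreover have "\<bar>max (- a') 0 - max (- a) 0\<bar> \<le> \<bar>a' - a\<bar>"
    by linarith
  ultimately show ?thesis
    using smooth_step_lipschitz[of b' b] tent_lipschitz[of "a' + 1" "a + 1"]
    unfolding link_snd_def by argo
qed

lemma link_fst_nonpos: "link_fst b a \<le> 0"
  using tent_bounds[of b] smooth_step_bounds[of "a + 1"] by (simp add: link_fst_def)

lemma link_snd_nonpos: "link_snd b a \<le> 0"
  using mult_nonneg_nonneg[OF smooth_step_bounds(1) tent_bounds(1), of b "a + 1"]
  unfolding link_snd_def by linarith

text \<open>With \<open>link_snd_zero\<close> this is the zero-chain property: a coordinate that is
  zero and has a zero predecessor gets derivative zero, whatever its successor is.\<close>

lemma link_fst_zero: "link_fst 0 a = 0"
  by (simp add: link_fst_def tent_def)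

lemma link_snd_zero: "link_snd 0 0 = 0"
  by (simp add: link_snd_def smooth_step_eq)

lemma link_ge: "- 1 \<le> link b a"
proof -
  have "smooth_step b * smooth_step (a + 1) \<le> 1"
    using smooth_step_bounds by (intro mult_le_one)
  moreover have "0 \<le> ramp_sq (- a)"
    by (simp add: ramp_sq_def)
  ultimately show ?thesis
    unfolding link_def by linarith
qed

lemma link_zero_le: "link b 0 \<le> 0"
  using smooth_step_bounds by (simp add: link_def ramp_sq_def)

text \<open>A predecessor that is on, next to a successor that is not, forces a definite slope.
  Below -1/2 the quadratic ramp alone yields at least 1/2; otherwise the product of a step value of
  at least 1/32 and a \<open>tent\<close> value of at least 1/4 yields 1/128.\<close>

lemma link_snd_le:
  assumes "1 / 4 \<le> b" "a \<le> 3 / 4"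
  shows "link_snd b a \<le> - 1 / 128"
proof (cases "a \<le> - 1 / 2")
  case True
  then show ?thesis
    using mult_nonneg_nonneg[OF smooth_step_bounds(1) tent_bounds(1), of b "a + 1"]
    by (simp add: link_snd_def max_def)
next
  case False
  have "1 / 32 \<le> smooth_step b"
  proof -
    have "(1 / 4)\<^sup>2 \<le> b\<^sup>2"
      using assms(1) by (intro power_mono) auto
    then have "1 / 16 \<le> b\<^sup>2"
      by (simp add: power2_eq_square)
    moreover have "(2 - b)\<^sup>2 \<le> 1" if "1 < b" "b \<le> 2"
      using that by (simp add: power_le_one)
    moreover have "\<not> b \<le> 0"
      using assms(1) by linarith
    ultimately show ?thesis
      unfolding smooth_step_eq by (auto simp: not_le)
  qed
  moreover have "1 / 4 \<le> tent (a + 1)"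
    using False assms(2) by (simp add: tent_def max_def)
  ultimately have "1 / 32 * (1 / 4) \<le> smooth_step b * tent (a + 1)"
    by (intro mult_mono) auto
  moreover have "0 \<le> max (- a) 0"
    by simp
  ultimately show ?thesis
    unfolding link_snd_def by argo
qed

section \<open>Vectors, gradients and singular values\<close>

lemma vnorm_sq: "v \<in> carrier_vec n \<Longrightarrow> (vnorm v)\<^sup>2 = (\<Sum>i<n. (v $ i)\<^sup>2)"
  unfolding vnorm_def scalar_prod_def
  by (auto simp: sum_nonneg power2_eq_square lessThan_atLeast0)

lemma vnorm_nonneg: "0 \<le> vnorm v"
  by (auto simp: vnorm_def scalar_prod_def sum_nonneg)

lemma scalar_prod_sum: "v \<in> carrier_vec n \<Longrightarrow> w \<in> carrier_vec n \<Longrightarrow> v \<bullet> w = (\<Sum>i<n. v $ i * w $ i)"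
  for v w :: "real vec"
  by (auto simp: scalar_prod_def lessThan_atLeast0)

lemma abs_index_le_vnorm: "v \<in> carrier_vec n \<Longrightarrow> i < n \<Longrightarrow> \<bar>v $ i\<bar> \<le> vnorm v"
proof (rule abs_le_square_iff[THEN iffD2, of "v $ i" "vnorm v", simplified abs_of_nonneg[OF vnorm_nonneg]])
  assume v: "v \<in> carrier_vec n" and i: "i < n"
  then show "(v $ i)\<^sup>2 \<le> (vnorm v)\<^sup>2"
    unfolding vnorm_sq[OF v] by (intro member_le_sum) auto
qed

lemma vnorm_smult: "vnorm (c \<cdot>\<^sub>v v) = \<bar>c\<bar> * vnorm v"
proof (rule power2_eq_imp_eq)
  have v: "v \<in> carrier_vec (dim_vec v)" by simp
  show "(vnorm (c \<cdot>\<^sub>v v))\<^sup>2 = (\<bar>c\<bar> * vnorm v)\<^sup>2"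
    using vnorm_sq[OF v] vnorm_sq[of "c \<cdot>\<^sub>v v" "dim_vec v"]
    by (simp add: power_mult_distrib sum_distrib_left)
qed (simp_all add: vnorm_nonneg)

lemma vnorm_eq_0_iff: "v \<in> carrier_vec n \<Longrightarrow> vnorm v = 0 \<longleftrightarrow> v = 0\<^sub>v n"
proof
  assume v: "v \<in> carrier_vec n" and "vnorm v = 0"
  then show "v = 0\<^sub>v n"
    using abs_index_le_vnorm[OF v] by (intro eq_vecI) auto
qed (simp add: vnorm_def)

lemma vnorm_minus_commute:
  "v \<in> carrier_vec n \<Longrightarrow> w \<in> carrier_vec n \<Longrightarrow> vnorm (v - w) = vnorm (w - v)"
  by (rule power2_eq_imp_eq) (simp_all add: vnorm_nonneg vnorm_sq[of _ n] power2_commute)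

text \<open>Both expansions are compared along \<open>d = g - g'\<close>; dividing out the step
  length leaves \<open>vnorm d \<le> 2 * e\<close> for every positive \<open>e\<close>. This makes
  the definite description in \<open>gradient\<close> meaningful.\<close>

lemma has_gradient_unique:
  assumes x: "x \<in> carrier_vec n" and "has_gradient n f x g" "has_gradient n f x g'"
  shows "g = g'"
proof -
  have g: "g \<in> carrier_vec n" "g' \<in> carrier_vec n"
    using assms by (auto simp: has_gradient_def)
  define d where "d = g - g'"
  have d: "d \<in> carrier_vec n" using g by (simp add: d_def)
  have "vnorm d \<le> 2 * e" if e: "e > 0" for e
  proof -
    obtain r where r: "r > 0" "\<And>y. y \<in> carrier_vec n \<Longrightarrow> vnorm (y - x) < r \<Longrightarrow>
        \<bar>f y - f x - g \<bullet> (y - x)\<bar> \<le> e * vnorm (y - x)"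
      using assms(2) e unfolding has_gradient_def by metis
    obtain r' where r': "r' > 0" "\<And>y. y \<in> carrier_vec n \<Longrightarrow> vnorm (y - x) < r' \<Longrightarrow>
        \<bar>f y - f x - g' \<bullet> (y - x)\<bar> \<le> e * vnorm (y - x)"
      using assms(3) e unfolding has_gradient_def by metis
    \<comment> \<open>The summand 1 keeps the step defined for \<open>d = 0\<close> and strictly
      inside both radii.\<close>
    define t where "t = min r r' / (vnorm d + 1)"
    define y where "y = x + t \<cdot>\<^sub>v d"
    have t: "t > 0"
      unfolding t_def using r(1) r'(1) vnorm_nonneg[of d] by (intro divide_pos_pos) auto
    have y: "y \<in> carrier_vec n" using x d by (simp add: y_def)
    have yx: "y - x = t \<cdot>\<^sub>v d" using x d by (auto simp: y_def)
    have norm: "vnorm (y - x) = t * vnorm d"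
      using t by (simp add: yx vnorm_smult)
    have "t * vnorm d < t * (vnorm d + 1)" using t by simp
    also have "\<dots> = min r r'"
      unfolding t_def using vnorm_nonneg[of d] by simp
    finally have "vnorm (y - x) < r" "vnorm (y - x) < r'" using norm by auto
    with r(2)[OF y] r'(2)[OF y] have "\<bar>g \<bullet> (y - x) - g' \<bullet> (y - x)\<bar> \<le> 2 * (e * vnorm (y - x))"
      by linarith
    moreover have "g \<bullet> (y - x) - g' \<bullet> (y - x) = t * (d \<bullet> d)"
      using g d yx by (simp add: d_def minus_scalar_prod_distrib[of _ n] right_diff_distrib)
    moreover have "d \<bullet> d = (vnorm d)\<^sup>2"
      using d vnorm_sq[OF d] by (simp add: scalar_prod_sum[of _ n] power2_eq_square)
    ultimately have "t * (vnorm d)\<^sup>2 \<le> 2 * (e * (t * vnorm d))"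
      using t norm by simp
    then have "(t * vnorm d) * vnorm d \<le> (t * vnorm d) * (2 * e)"
      by (simp add: power2_eq_square mult_ac)
    then show ?thesis
      using t e vnorm_nonneg[of d] by (cases "vnorm d = 0") (simp_all add: mult_le_cancel_left)
  qed
  from this[of "vnorm d / 4"] have "vnorm d = 0"
    using vnorm_nonneg[of d] by (cases "vnorm d = 0") auto
  then have "d = 0\<^sub>v n" using d by (simp add: vnorm_eq_0_iff)
  show ?thesis
  proof (rule eq_vecI)
    fix i assume "i < dim_vec g'"
    then have i: "i < n" using g by simp
    then have "d $ i = 0" using \<open>d = 0\<^sub>v n\<close> by simp
    then show "g $ i = g' $ i" using i g by (simp add: d_def)
  qed (use g in simp)
qed

lemma gradient_eqI: "x \<in> carrier_vec n \<Longrightarrow> has_gradient n f x g \<Longrightarrow> gradient n f x = g"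
  unfolding gradient_def by (blast intro: has_gradient_unique the_equality)

lemma has_gradientI_quadratic:
  assumes "g \<in> carrier_vec n" "0 < K"
    and "\<And>y. y \<in> carrier_vec n \<Longrightarrow> \<bar>f y - f x - g \<bullet> (y - x)\<bar> \<le> K * (vnorm (y - x))\<^sup>2"
  shows "has_gradient n f x g"
  unfolding has_gradient_def
proof (intro conjI allI impI)
  fix e :: real assume e: "e > 0"
  show "\<exists>d>0. \<forall>y\<in>carrier_vec n. vnorm (y - x) < d \<longrightarrow>
      \<bar>f y - f x - g \<bullet> (y - x)\<bar> \<le> e * vnorm (y - x)"
  proof (intro exI[of _ "e / K"] conjI ballI impI)
    fix y :: "real vec" assume y: "y \<in> carrier_vec n" "vnorm (y - x) < e / K"
    have "\<bar>f y - f x - g \<bullet> (y - x)\<bar> \<le> (K * vnorm (y - x)) * vnorm (y - x)"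
      using assms(3)[OF y(1)] by (simp add: power2_eq_square mult_ac)
    also have "\<dots> \<le> e * vnorm (y - x)"
      using y(2) assms(2) by (intro mult_right_mono vnorm_nonneg) (simp add: field_simps)
    finally show "\<bar>f y - f x - g \<bullet> (y - x)\<bar> \<le> e * vnorm (y - x)" .
  qed (use e assms(2) in simp)
qed (fact assms)

lemma smoothI:
  assumes "\<And>x. x \<in> carrier_vec n \<Longrightarrow> has_gradient n f x (g x)"
    and "\<And>x y. x \<in> carrier_vec n \<Longrightarrow> y \<in> carrier_vec n \<Longrightarrow> vnorm (g x - g y) \<le> L * vnorm (x - y)"
  shows "smooth n L f"
  unfolding smooth_def using assms gradient_eqI[OF _ assms(1)] by auto

lemma vspan_coordinate_zero:
  assumes "S \<subseteq> carrier_vec n" "\<And>v. v \<in> S \<Longrightarrow> v $ i = 0" "i < n" "u \<in> vspan n S"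
  shows "u $ i = 0"
proof -
  interpret vec_space "TYPE(real)" n .
  from assms(4) obtain a A where A: "u = lincomb a A" "finite A" "A \<subseteq> S"
    unfolding span_def by auto
  then show ?thesis
    using assms(1-3) by (subst A(1), subst lincomb_index) (auto intro!: sum.neutral)
qed

lemma vspan_carrier: "S \<subseteq> carrier_vec n \<Longrightarrow> u \<in> vspan n S \<Longrightarrow> u \<in> carrier_vec n"
proof -
  interpret vec_space "TYPE(real)" n .
  show "S \<subseteq> carrier_vec n \<Longrightarrow> u \<in> vspan n S \<Longrightarrow> u \<in> carrier_vec n"
    using span_closed by auto
qed

section \<open>Condition number from bounds on the transpose\<close>

lemma scalar_prod_le_AM_GM:
  assumes z: "z \<in> carrier_vec n" and x: "x \<in> carrier_vec n" and t: "0 < t"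
  shows "2 * (z \<bullet> x) \<le> t * (vnorm x)\<^sup>2 + (vnorm z)\<^sup>2 / t"
proof -
  have "2 * (a * b) \<le> t * b\<^sup>2 + a\<^sup>2 / t" for a b :: real
  proof -
    have "0 \<le> (t * b - a)\<^sup>2 / t"
      using t by simp
    also have "\<dots> = t * b\<^sup>2 + a\<^sup>2 / t - 2 * (a * b)"
      using t by (simp add: power2_eq_square field_simps)
    finally show ?thesis
      by simp
  qed
  then have "(\<Sum>i<n. 2 * (z $ i * x $ i)) \<le> (\<Sum>i<n. t * (x $ i)\<^sup>2 + (z $ i)\<^sup>2 / t)"
    by (intro sum_mono)
  then show ?thesis
    unfolding scalar_prod_sum[OF z x] vnorm_sq[OF x] vnorm_sq[OF z]
    by (simp add: sum.distrib sum_distrib_left sum_divide_distrib)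
qed

text \<open>For \<open>r \<le> c\<close> the singular values come from
  \<open>A * transpose_mat A\<close>, and an eigenvalue of this matrix is a quotient of the squared
  norms of \<open>transpose_mat A *\<^sub>v v\<close> and \<open>v\<close>, so
  \<open>\<alpha>\<close> bounds it from below. The eigenvector \<open>w\<close> keeps the spectrum
  nonempty, so that \<open>Min\<close> is attained.\<close>

lemma condition_number_leI:
  assumes A: "A \<in> carrier_mat r c" and "r \<le> c" and "0 < \<alpha>" "0 < \<beta>"
    and lower: "\<And>v. v \<in> carrier_vec r \<Longrightarrow> \<alpha> * (vnorm v)\<^sup>2 \<le> (vnorm (transpose_mat A *\<^sub>v v))\<^sup>2"
    and upper: "\<And>v. v \<in> carrier_vec r \<Longrightarrow> (vnorm (transpose_mat A *\<^sub>v v))\<^sup>2 \<le> \<beta> * (vnorm v)\<^sup>2"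
    and ev: "eigenvector (A * transpose_mat A) w \<mu>"
    and "sqrt (\<beta> / \<alpha>) \<le> \<kappa>"
  shows "condition_number_le A \<kappa>"
proof -
  define M where "M = A * transpose_mat A"
  have At: "transpose_mat A \<in> carrier_mat c r" using A by simp
  have M: "M \<in> carrier_mat r r" using A by (simp add: M_def)
  have sv: "singular_values A = sqrt ` spectrum M"
    using A \<open>r \<le> c\<close> by (simp add: singular_values_def M_def)
  have fin: "finite (singular_values A)"
    unfolding sv using card_finite_spectrum(1)[OF M] by simp
  have "\<mu> \<in> spectrum M"
    using ev unfolding spectrum_def eigenvalue_def M_def by auto
  then have ne: "singular_values A \<noteq> {}" by (auto simp: sv)
  have norm_sq: "v \<bullet> v = (vnorm v)\<^sup>2" for v :: "real vec"
    by (simp add: vnorm_def scalar_prod_def sum_nonneg)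
  have "\<alpha> \<le> k" if k: "k \<in> spectrum M" for k
  proof -
    obtain v where v: "v \<in> carrier_vec r" "v \<noteq> 0\<^sub>v r" "M *\<^sub>v v = k \<cdot>\<^sub>v v"
      using k M unfolding spectrum_def eigenvalue_def eigenvector_def by auto
    have "(vnorm (transpose_mat A *\<^sub>v v))\<^sup>2 = v \<bullet> (M *\<^sub>v v)"
      using A At v(1) unfolding M_def norm_sq[symmetric]
      by (simp add: assoc_mult_mat_vec[of _ r c _ r] transpose_vec_mult_scalar[of _ r c])
    also have "\<dots> = k * (vnorm v)\<^sup>2"
      using v by (simp add: norm_sq)
    finally have "\<alpha> * (vnorm v)\<^sup>2 \<le> k * (vnorm v)\<^sup>2" using lower[OF v(1)] by simp
    moreover have "(vnorm v)\<^sup>2 > 0" using v vnorm_eq_0_iff[OF v(1)] by simp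
    ultimately show ?thesis by (simp add: mult_le_cancel_right)
  qed
  then have "sqrt \<alpha> \<le> min_singular_value A"
    unfolding min_singular_value_def using fin ne by (auto simp: sv)
  moreover have "op_norm A \<le> sqrt \<beta>"
    unfolding op_norm_def
  proof (rule cSUP_least)
    show "{v \<in> carrier_vec (dim_col A). vnorm v \<le> 1} \<noteq> {}"
      using vnorm_eq_0_iff[of "0\<^sub>v (dim_col A)" "dim_col A"] by (auto intro!: exI[of _ "0\<^sub>v (dim_col A)"])
    fix x assume "x \<in> {v \<in> carrier_vec (dim_col A). vnorm v \<le> 1}"
    then have x: "x \<in> carrier_vec c" "vnorm x \<le> 1" using A by auto
    define y where "y = A *\<^sub>v x"
    define z where "z = transpose_mat A *\<^sub>v y"
    have y: "y \<in> carrier_vec r" and z: "z \<in> carrier_vec c"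
      using A x by (auto simp: y_def z_def)
    have "(vnorm y)\<^sup>2 = z \<bullet> x"
      using A x y unfolding norm_sq[symmetric] by (simp add: z_def y_def transpose_vec_mult_scalar[of _ r c])
    \<comment> \<open>With weight \<open>\<beta>\<close> the last term is at most the squared norm
      of \<open>y\<close> and can be absorbed on the left, which transfers the upper bound from the
      transpose to \<open>A\<close>.\<close>
    moreover have "2 * (z \<bullet> x) \<le> \<beta> * (vnorm x)\<^sup>2 + (vnorm z)\<^sup>2 / \<beta>"
      using z x(1) \<open>0 < \<beta>\<close> by (rule scalar_prod_le_AM_GM)
    moreover have "(vnorm z)\<^sup>2 / \<beta> \<le> (vnorm y)\<^sup>2"
      using upper[OF y] \<open>0 < \<beta>\<close> by (simp add: z_def field_simps)
    moreover have "\<beta> * (vnorm x)\<^sup>2 \<le> \<beta> * 1"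
      using x(2) vnorm_nonneg[of x] \<open>0 < \<beta>\<close> by (intro mult_left_mono power_le_one) auto
    ultimately have "(vnorm y)\<^sup>2 \<le> \<beta>"
      by linarith
    then show "vnorm (A *\<^sub>v x) \<le> sqrt \<beta>"
      by (simp add: y_def real_le_rsqrt)
  qed
  moreover have "0 < sqrt \<alpha>" using \<open>0 < \<alpha>\<close> by simp
  ultimately have "0 < min_singular_value A" "op_norm A / min_singular_value A \<le> sqrt \<beta> / sqrt \<alpha>"
    using \<open>0 < \<beta>\<close> by (linarith, intro frac_le) simp_all
  then show ?thesis
    using assms(8) by (simp add: condition_number_le_def real_sqrt_divide)
qed

section \<open>The chain objective\<close>

text \<open>Re-indexes links from their right end to their left end over an unchanged range, so that
  both kinds of contributions to a derivative can be summed together.\<close>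

lemma sum_shift:
  fixes h :: "nat \<Rightarrow> real"
  shows "(\<Sum>c<n. if c = 0 then 0 else h (c - 1)) = (\<Sum>c<n. if Suc c < n then h c else 0)"
proof (induction n)
  case (Suc n)
  have "(\<Sum>c<Suc n. if c = 0 then 0 else h (c - 1)) = (\<Sum>c<n. h c)"
    by (subst sum.lessThan_Suc_shift) (simp only: diff_Suc_1 if_True add_0_left nat.simps if_False refl)
  moreover have "(\<Sum>c<Suc n. if Suc c < Suc n then h c else 0) = (\<Sum>c<n. if Suc c < Suc n then h c else 0)"
    by (subst sum.lessThan_Suc) (simp only: less_irrefl if_False add_0_right)
  moreover have "\<dots> = (\<Sum>c<n. h c)"
    by (rule sum.cong) simp_all
  ultimately show ?case by (simp only:)
qed simp

lemma sum_shift_le: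
  fixes h :: "nat \<Rightarrow> real"
  assumes "\<And>c. 0 \<le> h c"
  shows "(\<Sum>c<n. if c = 0 then 0 else h (c - 1)) \<le> (\<Sum>c<n. h c)"
  unfolding sum_shift using assms by (intro sum_mono) auto

text \<open>The value 2 acts as a predecessor of coordinate 0 that is already switched on.\<close>

definition prev_coord :: "(nat \<Rightarrow> real) \<Rightarrow> nat \<Rightarrow> real" where
  "prev_coord X c = (if c = 0 then 2 else X (c - 1))"

definition chain :: "nat \<Rightarrow> nat \<Rightarrow> (nat \<Rightarrow> real) \<Rightarrow> real" where
  "chain m n X = (\<Sum>c<n. if m dvd c then link (prev_coord X c) (X c) else 0)"

definition chain_deriv :: "nat \<Rightarrow> nat \<Rightarrow> (nat \<Rightarrow> real) \<Rightarrow> nat \<Rightarrow> real" where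
  "chain_deriv m n X c =
     (if m dvd c then link_snd (prev_coord X c) (X c) else 0) +
     (if Suc c < n \<and> m dvd Suc c then link_fst (X c) (X (Suc c)) else 0)"

text \<open>Each link costs 7 times the squared increments of its two ends, and a coordinate is an
  end of at most two links. \<open>E\<close> is the increment of the predecessor; it is 0 at
  coordinate 0, whose predecessor is constant.\<close>

lemma chain_remainder:
  "\<bar>chain m n Y - chain m n X - (\<Sum>c<n. chain_deriv m n X c * (Y c - X c))\<bar>
   \<le> 14 * (\<Sum>c<n. (Y c - X c)\<^sup>2)"
proof -
  define D where "D c = Y c - X c" for c
  define h where "h c = (if m dvd Suc c then link_fst (X c) (X (Suc c)) else 0) * D c" for c
  define E where "E c = (if c = 0 then 0 else D (c - 1))" for c
  have E_sq: "(E c)\<^sup>2 = (if c = 0 then 0 else (D (c - 1))\<^sup>2)" for c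
    by (simp add: E_def)
  define t where "t c = (if m dvd c then link (prev_coord Y c) (Y c) - link (prev_coord X c) (X c)
      - link_fst (prev_coord X c) (X c) * E c - link_snd (prev_coord X c) (X c) * D c else 0)" for c
  have E: "E c = prev_coord Y c - prev_coord X c" for c
    by (simp add: E_def D_def prev_coord_def)
  have "(\<Sum>c<n. chain_deriv m n X c * D c)
      = (\<Sum>c<n. (if m dvd c then link_snd (prev_coord X c) (X c) * D c else 0)) + (\<Sum>c<n. if Suc c < n then h c else 0)"
    unfolding sum.distrib[symmetric] by (intro sum.cong) (auto simp: chain_deriv_def h_def distrib_right)
  also have "(\<Sum>c<n. if Suc c < n then h c else 0) = (\<Sum>c<n. if m dvd c then link_fst (prev_coord X c) (X c) * E c else 0)"
    unfolding sum_shift[symmetric] by (intro sum.cong) (auto simp: h_def E_def prev_coord_def)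
  finally have deriv: "(\<Sum>c<n. chain_deriv m n X c * D c)
      = (\<Sum>c<n. (if m dvd c then link_snd (prev_coord X c) (X c) * D c else 0) +
          (if m dvd c then link_fst (prev_coord X c) (X c) * E c else 0))"
    by (simp only: sum.distrib)
  have "chain m n Y - chain m n X - (\<Sum>c<n. chain_deriv m n X c * D c) = (\<Sum>c<n. t c)"
    unfolding deriv chain_def sum_subtractf[symmetric] by (intro sum.cong refl) (simp add: t_def)
  moreover have "\<bar>\<Sum>c<n. t c\<bar> \<le> (\<Sum>c<n. 7 * ((E c)\<^sup>2 + (D c)\<^sup>2))"
  proof (rule order_trans[OF sum_abs], rule sum_mono)
    fix c
    show "\<bar>t c\<bar> \<le> 7 * ((E c)\<^sup>2 + (D c)\<^sup>2)"
      using link_remainder[of "prev_coord Y c" "Y c" "prev_coord X c" "X c"]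
      unfolding t_def E D_def by simp
  qed
  moreover have "(\<Sum>c<n. (E c)\<^sup>2) \<le> (\<Sum>c<n. (D c)\<^sup>2)"
    using sum_shift_le[of "\<lambda>c. (D c)\<^sup>2" n] unfolding E_sq by simp
  ultimately show ?thesis
    unfolding D_def[symmetric] by (simp add: sum.distrib sum_distrib_left[symmetric])
qed

text \<open>A derivative sees its own coordinate through two links and each neighbour through one,
  whence 3 (E + 2 D + F). Squaring gives 36 (E^2 + 2 D^2 + F^2), and summing over the shifted copies
  gives 36 * 4 = 144.\<close>

lemma chain_deriv_lipschitz:
  "(\<Sum>c<n. (chain_deriv m n Y c - chain_deriv m n X c)\<^sup>2) \<le> 144 * (\<Sum>c<n. (Y c - X c)\<^sup>2)"
proof -
  define D where "D c = \<bar>Y c - X c\<bar>" for c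
  define E where "E c = (if c = 0 then 0 else D (c - 1))" for c
  have E_sq: "(E c)\<^sup>2 = (if c = 0 then 0 else (D (c - 1))\<^sup>2)" for c
    by (simp add: E_def)
  define F where "F c = (if Suc c < n then D (Suc c) else 0)" for c
  \<comment> \<open>Cauchy-Schwarz with weights 1, 2, 1, proved by exhibiting the difference as a
    sum of squares.\<close>
  have sq: "(p + 2 * d + q)\<^sup>2 \<le> 4 * (p\<^sup>2 + 2 * d\<^sup>2 + q\<^sup>2)" for p d q :: real
  proof -
    have "4 * (p\<^sup>2 + 2 * d\<^sup>2 + q\<^sup>2) - (p + 2 * d + q)\<^sup>2 = 2 * (p - d)\<^sup>2 + 2 * (d - q)\<^sup>2 + (p - q)\<^sup>2"
      by (simp add: power2_eq_square algebra_simps)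
    moreover have "0 \<le> 2 * (p - d)\<^sup>2 + 2 * (d - q)\<^sup>2 + (p - q)\<^sup>2"
      by simp
    ultimately show ?thesis by linarith
  qed
  have "(chain_deriv m n Y c - chain_deriv m n X c)\<^sup>2 \<le> 36 * ((E c)\<^sup>2 + 2 * (D c)\<^sup>2 + (F c)\<^sup>2)"
    if "c < n" for c
  proof -
    have "\<bar>(if m dvd c then link_snd (prev_coord Y c) (Y c) else 0) -
        (if m dvd c then link_snd (prev_coord X c) (X c) else 0)\<bar> \<le> 3 * (E c + D c)"
      using link_snd_lipschitz[of "prev_coord Y c" "Y c" "prev_coord X c" "X c"]
      by (auto simp: E_def D_def prev_coord_def)
    moreover have "\<bar>(if Suc c < n \<and> m dvd Suc c then link_fst (Y c) (Y (Suc c)) else 0) -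
        (if Suc c < n \<and> m dvd Suc c then link_fst (X c) (X (Suc c)) else 0)\<bar> \<le> 3 * (D c + F c)"
      using link_fst_lipschitz[of "Y c" "Y (Suc c)" "X c" "X (Suc c)"]
      by (auto simp: F_def D_def)
    ultimately have "\<bar>chain_deriv m n Y c - chain_deriv m n X c\<bar> \<le> 3 * (E c + 2 * D c + F c)"
      unfolding chain_deriv_def by argo
    then have "\<bar>chain_deriv m n Y c - chain_deriv m n X c\<bar>\<^sup>2 \<le> (3 * (E c + 2 * D c + F c))\<^sup>2"
      by (intro power_mono) auto
    also have "\<dots> = 9 * (E c + 2 * D c + F c)\<^sup>2"
      by (simp only: power_mult_distrib) simp
    also have "\<dots> \<le> 9 * (4 * ((E c)\<^sup>2 + 2 * (D c)\<^sup>2 + (F c)\<^sup>2))"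
      using sq by (intro mult_left_mono) auto
    finally show ?thesis by simp
  qed
  then have "(\<Sum>c<n. (chain_deriv m n Y c - chain_deriv m n X c)\<^sup>2)
      \<le> (\<Sum>c<n. 36 * ((E c)\<^sup>2 + 2 * (D c)\<^sup>2 + (F c)\<^sup>2))"
    by (intro sum_mono) auto
  also have "\<dots> = 36 * ((\<Sum>c<n. (E c)\<^sup>2) + 2 * (\<Sum>c<n. (D c)\<^sup>2) + (\<Sum>c<n. (F c)\<^sup>2))"
    by (simp add: sum.distrib sum_distrib_left)
  also have "(\<Sum>c<n. (E c)\<^sup>2) \<le> (\<Sum>c<n. (D c)\<^sup>2)"
    using sum_shift_le[of "\<lambda>c. (D c)\<^sup>2" n] unfolding E_sq by simp
  also have "(\<Sum>c<n. (F c)\<^sup>2) = (\<Sum>c<n. if c = 0 then 0 else (D c)\<^sup>2)"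
  proof -
    have "(\<Sum>c<n. (F c)\<^sup>2) = (\<Sum>c<n. if Suc c < n then (D (Suc c))\<^sup>2 else 0)"
      by (intro sum.cong) (auto simp: F_def)
    then show ?thesis
      unfolding sum_shift[symmetric] by (auto intro!: sum.cong)
  qed
  also have "\<dots> \<le> (\<Sum>c<n. (D c)\<^sup>2)"
    by (intro sum_mono) auto
  finally show ?thesis
    by (simp add: D_def)
qed

lemma chain_deriv_nonpos: "chain_deriv m n X c \<le> 0"
  using link_fst_nonpos link_snd_nonpos by (simp add: chain_deriv_def add_nonpos_nonpos)

text \<open>Only the \<open>T\<close> block starts carry a link, and each link is at least -1. The
  bound is free of \<open>m\<close>, so the block length does not enter the objective gap.\<close>

lemma chain_ge:
  assumes "0 < m"
  shows "- real T \<le> chain m (T * m) X"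
proof -
  have "- real T = (\<Sum>i<T. - 1)" by simp
  also have "\<dots> \<le> (\<Sum>i<T. \<Sum>c=i*m..<i*m+m. if c = i * m then - 1 else 0)"
  proof (intro sum_mono)
    fix i
    have "(\<Sum>c=i*m..<i*m+m. if c = i * m then - 1 else 0 :: real) = - 1"
      using assms by (subst sum.delta) simp_all
    then show "- 1 \<le> (\<Sum>c=i*m..<i*m+m. if c = i * m then - 1 else 0 :: real)"
      by (simp only: order_refl)
  qed
  also have "\<dots> \<le> (\<Sum>i<T. \<Sum>c=i*m..<i*m+m. if m dvd c then link (prev_coord X c) (X c) else 0)"
  proof (intro sum_mono)
    fix i c assume c: "c \<in> {i*m..<i*m+m}"
    have "c div m = i"
    proof (rule div_nat_eqI)
      show "m * i \<le> c" "c < m * Suc i"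
        using c unfolding mult_Suc_right mult.commute[of m i] by simp_all
    qed
    show "(if c = i * m then - 1 else 0) \<le> (if m dvd c then link (prev_coord X c) (X c) else 0)"
    proof (cases "m dvd c")
      case True
      have "c = i * m"
        using dvd_div_mult_self[OF True] unfolding \<open>c div m = i\<close> by (rule sym)
      with True show ?thesis
        using link_ge[of "prev_coord X c" "X c"] by simp
    qed simp
  qed
  also have "\<dots> = chain m (T * m) X"
    unfolding chain_def by (rule sum.nat_group)
  finally show ?thesis .
qed

lemma chain_zero_le: "chain m n (\<lambda>_. 0) \<le> 0"
  unfolding chain_def using link_zero_le by (intro sum_nonpos) auto

text \<open>The factor 1/12 offsets the Lipschitz constant 12, the root of 144, of the unscaled
  derivative, so the gradient is \<open>L\<close>-Lipschitz for every length scale \<open>s\<close>.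
  Gradient entries then scale with \<open>L * s\<close> and values with
  \<open>L * s\<^sup>2\<close>.\<close>

definition chain_objective :: "nat \<Rightarrow> nat \<Rightarrow> real \<Rightarrow> real \<Rightarrow> real vec \<Rightarrow> real" where
  "chain_objective m n L s x = L * s\<^sup>2 / 12 * chain m n (\<lambda>c. x $ c / s)"

definition chain_gradient :: "nat \<Rightarrow> nat \<Rightarrow> nat \<Rightarrow> real \<Rightarrow> real \<Rightarrow> real vec \<Rightarrow> real vec" where
  "chain_gradient m n N L s x =
     vec N (\<lambda>c. if c < n then L * s / 12 * chain_deriv m n (\<lambda>c. x $ c / s) c else 0)"

lemma sum_le_vnorm_sq:
  assumes v: "v \<in> carrier_vec N" and "n \<le> N"
  shows "(\<Sum>c<n. (v $ c)\<^sup>2) \<le> (vnorm v)\<^sup>2"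
  unfolding vnorm_sq[OF v] using assms(2) by (intro sum_mono2) auto

lemma sum_lessThan_if_less:
  fixes h :: "nat \<Rightarrow> real"
  assumes "n \<le> N"
  shows "(\<Sum>c<N. if c < n then h c else 0) = (\<Sum>c<n. h c)"
proof -
  have "(\<Sum>c<N. if c < n then h c else 0) = (\<Sum>c<n. if c < n then h c else 0)"
    using assms by (intro sum.mono_neutral_right) auto
  also have "\<dots> = (\<Sum>c<n. h c)"
    by (intro sum.cong refl) (simp only: lessThan_iff if_True)
  finally show ?thesis .
qed

lemma has_gradient_chain_objective:
  assumes "n \<le> N" "0 < L" "0 < s" and x: "x \<in> carrier_vec N"
  shows "has_gradient N (chain_objective m n L s) x (chain_gradient m n N L s x)"
proof (rule has_gradientI_quadratic)
  show g: "chain_gradient m n N L s x \<in> carrier_vec N"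
    by (simp add: chain_gradient_def)
  show "0 < 14 * L / 12" using assms by simp
  fix y :: "real vec" assume y: "y \<in> carrier_vec N"
  define X where "X c = x $ c / s" for c
  define Y where "Y c = y $ c / s" for c
  have d: "y $ c - x $ c = s * (Y c - X c)" for c
    using \<open>0 < s\<close> by (simp add: X_def Y_def field_simps)
  have "chain_gradient m n N L s x \<bullet> (y - x)
      = (\<Sum>c<N. if c < n then L * s / 12 * chain_deriv m n X c * (y $ c - x $ c) else 0)"
    using x y unfolding scalar_prod_sum[OF g minus_carrier_vec[OF y x]]
    by (intro sum.cong refl) (auto simp: chain_gradient_def X_def[abs_def])
  also have "\<dots> = (\<Sum>c<n. L * s / 12 * chain_deriv m n X c * (y $ c - x $ c))"
    using assms(1) by (rule sum_lessThan_if_less)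
  also have "\<dots> = L * s\<^sup>2 / 12 * (\<Sum>c<n. chain_deriv m n X c * (Y c - X c))"
    by (simp add: d sum_distrib_left power2_eq_square mult_ac)
  finally have "chain_objective m n L s y - chain_objective m n L s x - chain_gradient m n N L s x \<bullet> (y - x)
      = L * s\<^sup>2 / 12 * (chain m n Y - chain m n X - (\<Sum>c<n. chain_deriv m n X c * (Y c - X c)))"
    unfolding chain_objective_def X_def[symmetric] Y_def[symmetric] right_diff_distrib by simp
  also have "\<bar>\<dots>\<bar> = L * s\<^sup>2 / 12 * \<bar>chain m n Y - chain m n X - (\<Sum>c<n. chain_deriv m n X c * (Y c - X c))\<bar>"
    using assms by (simp add: abs_mult)
  also have "\<dots> \<le> L * s\<^sup>2 / 12 * (14 * (\<Sum>c<n. (Y c - X c)\<^sup>2))"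
    using assms by (intro mult_left_mono chain_remainder) auto
  also have "\<dots> = 14 * L / 12 * (\<Sum>c<n. ((y - x) $ c)\<^sup>2)"
  proof -
    have "(\<Sum>c<n. ((y - x) $ c)\<^sup>2) = (\<Sum>c<n. s\<^sup>2 * (Y c - X c)\<^sup>2)"
      using x y assms(1) by (intro sum.cong) (auto simp: d power_mult_distrib)
    then show ?thesis by (simp add: sum_distrib_left[symmetric] mult_ac)
  qed
  also have "\<dots> \<le> 14 * L / 12 * (vnorm (y - x))\<^sup>2"
    using assms x y by (intro mult_left_mono sum_le_vnorm_sq) auto
  finally show "\<bar>chain_objective m n L s y - chain_objective m n L s x - chain_gradient m n N L s x \<bullet> (y - x)\<bar>
      \<le> 14 * L / 12 * (vnorm (y - x))\<^sup>2" .
qed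

lemma gradient_chain_objective:
  assumes "n \<le> N" "0 < L" "0 < s" "x \<in> carrier_vec N"
  shows "gradient N (chain_objective m n L s) x = chain_gradient m n N L s x"
  using assms by (intro gradient_eqI has_gradient_chain_objective)

lemma smooth_chain_objective:
  assumes "n \<le> N" "0 < L" "0 < s"
  shows "smooth N L (chain_objective m n L s)"
proof (rule smoothI)
  fix x :: "real vec" assume "x \<in> carrier_vec N"
  then show "has_gradient N (chain_objective m n L s) x (chain_gradient m n N L s x)"
    using assms by (intro has_gradient_chain_objective)
next
  fix x y :: "real vec" assume x: "x \<in> carrier_vec N" and y: "y \<in> carrier_vec N"
  define X where "X c = x $ c / s" for c
  define Y where "Y c = y $ c / s" for c
  have carrier: "chain_gradient m n N L s x - chain_gradient m n N L s y \<in> carrier_vec N"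
    by (simp add: chain_gradient_def)
  have "(vnorm (chain_gradient m n N L s x - chain_gradient m n N L s y))\<^sup>2
      = (\<Sum>c<N. if c < n then (L * s / 12)\<^sup>2 * (chain_deriv m n X c - chain_deriv m n Y c)\<^sup>2 else 0)"
    unfolding vnorm_sq[OF carrier]
    by (intro sum.cong refl)
      (auto simp: chain_gradient_def X_def[abs_def] Y_def[abs_def] right_diff_distrib simp flip: power_mult_distrib)
  also have "\<dots> = (L * s / 12)\<^sup>2 * (\<Sum>c<n. (chain_deriv m n X c - chain_deriv m n Y c)\<^sup>2)"
    using assms(1) by (simp add: sum_lessThan_if_less sum_distrib_left)
  also have "\<dots> \<le> (L * s / 12)\<^sup>2 * (144 * (\<Sum>c<n. (X c - Y c)\<^sup>2))"
    by (intro mult_left_mono chain_deriv_lipschitz) auto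
  also have "\<dots> = L\<^sup>2 * (\<Sum>c<n. ((x - y) $ c)\<^sup>2)"
  proof -
    have "(\<Sum>c<n. ((x - y) $ c)\<^sup>2) = (\<Sum>c<n. s\<^sup>2 * (X c - Y c)\<^sup>2)"
      using x y assms(1,3)
      by (intro sum.cong) (auto simp: X_def Y_def diff_divide_distrib[symmetric] power_divide)
    then show ?thesis by (simp add: sum_distrib_left[symmetric] power_mult_distrib power_divide)
  qed
  also have "\<dots> \<le> L\<^sup>2 * (vnorm (x - y))\<^sup>2"
    using assms x y by (intro mult_left_mono sum_le_vnorm_sq) auto
  also have "\<dots> = (L * vnorm (x - y))\<^sup>2"
    by (simp add: power_mult_distrib)
  finally show "vnorm (chain_gradient m n N L s x - chain_gradient m n N L s y) \<le> L * vnorm (x - y)"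
    by (rule power2_le_imp_le) (use assms(2) vnorm_nonneg in simp)
qed

section \<open>The constraint matrix\<close>

text \<open>
  In each block the constraints make the \<open>m\<close> entries proportional to
  \<open>1, 1/\<surd>m, \<dots>, 1/\<surd>m, 1\<close>. The small inner weights bound the norm of this vector independently of
  \<open>m\<close>, which keeps the projected gradient large, while the smallest singular value remains of
  order \<open>1/m\<close>. A block has only \<open>m - 1\<close> such constraints; the row left over at its end fixes one
  of the additional coordinates \<open>n, \<dots>, 2n - 1\<close> to zero. This provides an explicit eigenvector of
  \<open>A A\<^sup>T\<close>, without which \<open>Min (singular_values A)\<close> could be a junk value.
\<close>

definition row_fst :: "nat \<Rightarrow> nat \<Rightarrow> real" where
  "row_fst m r = (if m dvd r then sqrt (1 / m) else 1)"

definition row_snd :: "nat \<Rightarrow> nat \<Rightarrow> real" where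
  "row_snd m r = (if m dvd Suc (Suc r) then sqrt (1 / m) else 1)"

definition path_weight :: "nat \<Rightarrow> nat \<Rightarrow> real" where
  "path_weight m c = (if m dvd c \<or> m dvd Suc c then 1 else sqrt (1 / m))"

definition path_mat :: "nat \<Rightarrow> nat \<Rightarrow> real mat" where
  "path_mat m n = mat n (2 * n) (\<lambda>(r, c).
     if m dvd Suc r then (if c = n + r then sqrt (2 / m) else 0)
     else if c = r then row_fst m r else if c = Suc r then - row_snd m r else 0)"

lemma path_mat_carrier: "path_mat m n \<in> carrier_mat n (2 * n)"
  by (simp add: path_mat_def)

lemma Suc_less_of_not_dvd:
  assumes "m dvd n" "\<not> m dvd Suc r" "r < n"
  shows "Suc r < n"
  using assms by (metis Suc_lessI)

lemma path_mat_mult: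
  assumes "m dvd n" "x \<in> carrier_vec (2 * n)" and r: "r < n"
  shows "(path_mat m n *\<^sub>v x) $ r =
    (if m dvd Suc r then sqrt (2 / m) * x $ (n + r) else row_fst m r * x $ r - row_snd m r * x $ Suc r)"
proof -
  have "(path_mat m n *\<^sub>v x) $ r = (\<Sum>c<2 * n. path_mat m n $$ (r, c) * x $ c)"
    using assms by (simp add: path_mat_def scalar_prod_def lessThan_atLeast0)
  also have "\<dots> = (if m dvd Suc r then sqrt (2 / m) * x $ (n + r) else row_fst m r * x $ r - row_snd m r * x $ Suc r)"
  proof (cases "m dvd Suc r")
    case True
    have "(\<Sum>c<2 * n. path_mat m n $$ (r, c) * x $ c)
        = (\<Sum>c<2 * n. if c = n + r then sqrt (2 / m) * x $ (n + r) else 0)"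
      using r True by (intro sum.cong refl) (simp add: path_mat_def)
    then show ?thesis using r True by simp
  next
    case False
    then have "Suc r < n" using assms by (intro Suc_less_of_not_dvd)
    have "(\<Sum>c<2 * n. path_mat m n $$ (r, c) * x $ c)
        = (\<Sum>c<2 * n. (if c = r then row_fst m r * x $ r else 0) - (if c = Suc r then row_snd m r * x $ Suc r else 0))"
      using r False by (intro sum.cong refl) (simp add: path_mat_def)
    then show ?thesis using \<open>Suc r < n\<close> False by (simp add: sum_subtractf)
  qed
  finally show ?thesis .
qed

lemma path_mat_transpose_mult:
  assumes dvd: "m dvd n" and v: "v \<in> carrier_vec n"
  shows "c < n \<Longrightarrow> (transpose_mat (path_mat m n) *\<^sub>v v) $ c =
      (if m dvd Suc c then 0 else row_fst m c * v $ c) - (if m dvd c then 0 else row_snd m (c - 1) * v $ (c - 1))"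
    and "c < n \<Longrightarrow> (transpose_mat (path_mat m n) *\<^sub>v v) $ (n + c) =
      (if m dvd Suc c then sqrt (2 / m) * v $ c else 0)"
proof -
  have eq: "(transpose_mat (path_mat m n) *\<^sub>v v) $ c = (\<Sum>r<n. path_mat m n $$ (r, c) * v $ r)"
    if "c < 2 * n" for c
    using v that by (simp add: path_mat_def scalar_prod_def lessThan_atLeast0)
  show "(transpose_mat (path_mat m n) *\<^sub>v v) $ c =
      (if m dvd Suc c then 0 else row_fst m c * v $ c) - (if m dvd c then 0 else row_snd m (c - 1) * v $ (c - 1))"
    if c: "c < n"
  proof -
    \<comment> \<open>For \<open>c = 0\<close> the truncated \<open>c - 1\<close> is 0 again, but
      \<open>m dvd 0\<close> removes that term.\<close>
    have "(transpose_mat (path_mat m n) *\<^sub>v v) $ c = (\<Sum>r<n.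
        (if r = c then (if m dvd Suc c then 0 else row_fst m c * v $ c) else 0) -
        (if r = c - 1 then (if m dvd c then 0 else row_snd m (c - 1) * v $ (c - 1)) else 0))"
      unfolding eq[OF trans_less_add1[OF c, of n, folded mult_2]]
    proof (intro sum.cong refl)
      fix r assume "r \<in> {..<n}"
      then have "r < n" by simp
      consider "c = r" | "c = Suc r" | "c \<noteq> r" "c \<noteq> Suc r" by blast
      then show "path_mat m n $$ (r, c) * v $ r =
          (if r = c then (if m dvd Suc c then 0 else row_fst m c * v $ c) else 0) -
          (if r = c - 1 then (if m dvd c then 0 else row_snd m (c - 1) * v $ (c - 1)) else 0)"
      proof cases
        case 1
        then show ?thesis using c \<open>r < n\<close> by (cases "c = 0") (simp_all add: path_mat_def)
      next
        case 2
        then show ?thesis using c \<open>r < n\<close> by (simp add: path_mat_def)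
      next
        case 3
        then show ?thesis using c \<open>r < n\<close> by (cases "c = 0") (auto simp: path_mat_def)
      qed
    qed
    also have "\<dots> = (if m dvd Suc c then 0 else row_fst m c * v $ c) -
        (if m dvd c then 0 else row_snd m (c - 1) * v $ (c - 1))"
      using c by (simp only: sum_subtractf sum.delta' sum.delta finite_lessThan lessThan_iff if_True less_imp_diff_less)
    finally show ?thesis .
  qed
  show "(transpose_mat (path_mat m n) *\<^sub>v v) $ (n + c) = (if m dvd Suc c then sqrt (2 / m) * v $ c else 0)"
    if c: "c < n"
  proof -
    have "(transpose_mat (path_mat m n) *\<^sub>v v) $ (n + c)
        = (\<Sum>r<n. if r = c then (if m dvd Suc c then sqrt (2 / m) * v $ c else 0) else 0)"
      unfolding eq[OF add_strict_left_mono[OF c, of n, folded mult_2]]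
    proof (intro sum.cong refl)
      fix r assume "r \<in> {..<n}"
      then have r: "r < n" by simp
      have "n + c \<noteq> Suc r" if "\<not> m dvd Suc r"
        using Suc_less_of_not_dvd[OF dvd that r] by simp
      then show "path_mat m n $$ (r, n + c) * v $ r
          = (if r = c then (if m dvd Suc c then sqrt (2 / m) * v $ c else 0) else 0)"
        using r c by (cases "m dvd Suc r") (auto simp: path_mat_def)
    qed
    then show ?thesis using c by simp
  qed
qed

lemma sum_lessThan_double:
  fixes h :: "nat \<Rightarrow> real"
  shows "(\<Sum>c<2 * n. h c) = (\<Sum>c<n. h c) + (\<Sum>c<n. h (n + c))"
proof -
  have "{..<2 * n} = {..<n} \<union> (+) n ` {..<n}"
  proof (intro equalityI subsetI)
    fix c assume "c \<in> {..<2 * n}"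
    then show "c \<in> {..<n} \<union> (+) n ` {..<n}"
      by (cases "c < n") (auto intro!: image_eqI[of _ _ "c - n"])
  qed auto
  also have "(\<Sum>c\<in>\<dots>. h c) = (\<Sum>c<n. h c) + (\<Sum>c\<in>(+) n ` {..<n}. h c)"
    by (intro sum.union_disjoint) auto
  also have "(\<Sum>c\<in>(+) n ` {..<n}. h c) = (\<Sum>c<n. h (n + c))"
    by (subst sum.reindex) (auto simp: inj_on_def)
  finally show ?thesis .
qed

text \<open>Row \<open>m - 1\<close> is the left-over row of the first block. It meets only the
  extra coordinate \<open>n + (m - 1)\<close>, and no other row meets that coordinate, so the row is
  orthogonal to all others and its squared length 2/m is an eigenvalue.\<close>

lemma eigenvector_path_mat:
  assumes "m dvd n" "0 < m" "0 < n"
  shows "eigenvector (path_mat m n * transpose_mat (path_mat m n)) (unit_vec n (m - 1)) (2 / m)"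
proof -
  obtain k where k: "m = Suc k" using assms(2) by (cases m) auto
  let ?A = "path_mat m n" and ?e = "unit_vec n k :: real vec"
  have m: "k < n" using assms dvd_imp_le[of m n] k by linarith
  have e: "?e \<in> carrier_vec n" by simp
  have At: "transpose_mat ?A \<in> carrier_mat (2 * n) n"
    using path_mat_carrier by simp
  have "transpose_mat ?A *\<^sub>v ?e = sqrt (2 / m) \<cdot>\<^sub>v unit_vec (2 * n) (n + k)"
  proof (rule eq_vecI)
    fix c assume "c < dim_vec (sqrt (2 / m) \<cdot>\<^sub>v unit_vec (2 * n) (n + k))"
    then have c: "c < 2 * n" by simp
    show "(transpose_mat ?A *\<^sub>v ?e) $ c = (sqrt (2 / m) \<cdot>\<^sub>v unit_vec (2 * n) (n + k)) $ c"
    proof (cases "c < n")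
      case True
      have "m dvd Suc c" if "c = k" using that k by simp
      then have "(if m dvd Suc c then 0 else row_fst m c * ?e $ c) = 0"
        using True m by (cases "c = k") (simp_all only: if_True index_unit_vec if_False mult_zero_right if_cancel)
      moreover have "(if m dvd c then 0 else row_snd m (c - 1) * ?e $ (c - 1)) = 0"
      proof (cases "c - 1 = k \<and> c \<noteq> 0")
        case True
        then have "c = m" using k by linarith
        then show ?thesis by simp
      next
        case False
        then show ?thesis using \<open>c < n\<close> m by (cases "c = 0") simp_all
      qed
      ultimately have "(transpose_mat ?A *\<^sub>v ?e) $ c = 0"
        unfolding path_mat_transpose_mult(1)[OF assms(1) e True] by simp
      then show ?thesis using True c m by simp
    next
      case False
      then obtain r where r: "c = n + r" "r < n" using c by (metis add_less_cancel_left le_Suc_ex mult_2 not_less)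
      show ?thesis
        unfolding r(1) path_mat_transpose_mult(2)[OF assms(1) e r(2)] using r m k by simp
    qed
  qed (use At in simp)
  then have "(?A * transpose_mat ?A) *\<^sub>v ?e = ?A *\<^sub>v (sqrt (2 / m) \<cdot>\<^sub>v unit_vec (2 * n) (n + k))"
    using assoc_mult_mat_vec[OF path_mat_carrier At e] by simp
  also have "\<dots> = (2 / m) \<cdot>\<^sub>v ?e"
  proof (rule eq_vecI)
    fix r assume "r < dim_vec ((2 / m) \<cdot>\<^sub>v ?e)"
    then have r: "r < n" by simp
    have x: "sqrt (2 / m) \<cdot>\<^sub>v unit_vec (2 * n) (n + k) \<in> carrier_vec (2 * n)" by simp
    show "(?A *\<^sub>v (sqrt (2 / m) \<cdot>\<^sub>v unit_vec (2 * n) (n + k))) $ r = ((2 / m) \<cdot>\<^sub>v ?e) $ r"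
    proof (cases "m dvd Suc r")
      case True
      then show ?thesis
        unfolding path_mat_mult[OF assms(1) x r] using r m k by simp
    next
      case False
      then have "r \<noteq> k" using k by auto
      then show ?thesis
        unfolding path_mat_mult[OF assms(1) x r]
        using r m False Suc_less_of_not_dvd[OF assms(1) False r] by simp
    qed
  qed (simp add: path_mat_def)
  moreover have "?e \<noteq> 0\<^sub>v n"
    using m by (metis index_unit_vec(1) index_zero_vec(1) zero_neq_one)
  ultimately show ?thesis
    using path_mat_carrier[of m n] k by (simp add: eigenvector_def)
qed

section \<open>Extreme singular values of the constraint matrix\<close>

lemma vnorm_path_mat_transpose:
  assumes dvd: "m dvd n" and v: "v \<in> carrier_vec n" and "0 < m"
  shows "(vnorm (transpose_mat (path_mat m n) *\<^sub>v v))\<^sup>2 =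
    (\<Sum>c<n. ((transpose_mat (path_mat m n) *\<^sub>v v) $ c)\<^sup>2 + (if m dvd Suc c then 2 / m * (v $ c)\<^sup>2 else 0))"
proof -
  have carrier: "transpose_mat (path_mat m n) *\<^sub>v v \<in> carrier_vec (2 * n)"
    using v path_mat_carrier[of m n] by auto
  show ?thesis
    unfolding vnorm_sq[OF carrier] sum_lessThan_double sum.distrib
    using v \<open>0 < m\<close> by (intro arg_cong2[where f = "(+)"] sum.cong refl)
      (simp add: path_mat_transpose_mult(2)[OF dvd] power_mult_distrib)
qed

lemma row_bounds:
  assumes "0 < m"
  shows "0 < row_fst m r" "row_fst m r \<le> 1" "0 < row_snd m r" "row_snd m r \<le> 1"
  using assms by (simp_all add: row_fst_def row_snd_def)

text \<open>A column among the first \<open>n\<close> meets at most two coupling rows, with entries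
  of modulus at most 1, which costs 4 in total; the pinned extra coordinates add at most 2/m \<le>
  1.\<close>

lemma vnorm_path_mat_transpose_le:
  assumes dvd: "m dvd n" and v: "v \<in> carrier_vec n" and "2 \<le> m"
  shows "(vnorm (transpose_mat (path_mat m n) *\<^sub>v v))\<^sup>2 \<le> 5 * (vnorm v)\<^sup>2"
proof -
  have m: "0 < m" using assms by simp
  have "((transpose_mat (path_mat m n) *\<^sub>v v) $ c)\<^sup>2 + (if m dvd Suc c then 2 / m * (v $ c)\<^sup>2 else 0)
      \<le> 2 * (v $ c)\<^sup>2 + 2 * (if c = 0 then 0 else (v $ (c - 1))\<^sup>2) + (v $ c)\<^sup>2" if c: "c < n" for c
  proof -
    define a where "a = (if m dvd Suc c then 0 else row_fst m c * v $ c)"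
    define b where "b = (if m dvd c then 0 else row_snd m (c - 1) * v $ (c - 1))"
    have "(a - b)\<^sup>2 \<le> 2 * a\<^sup>2 + 2 * b\<^sup>2"
      using zero_le_power2[of "a + b"] by (simp add: power2_eq_square algebra_simps)
    moreover have "a\<^sup>2 \<le> (v $ c)\<^sup>2"
      using row_bounds[OF m, of c] by (auto simp: a_def power_mult_distrib intro!: mult_left_le_one_le power_le_one)
    moreover have "b\<^sup>2 \<le> (if c = 0 then 0 else (v $ (c - 1))\<^sup>2)"
      using row_bounds[OF m, of "c - 1"] by (auto simp: b_def power_mult_distrib intro!: mult_left_le_one_le power_le_one)
    moreover have "(if m dvd Suc c then 2 / m * (v $ c)\<^sup>2 else 0) \<le> (v $ c)\<^sup>2"
      using assms(3) mult_left_le_one_le[of "(v $ c)\<^sup>2" "2 / m"] by simp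
    ultimately show ?thesis
      unfolding path_mat_transpose_mult(1)[OF dvd v c] a_def[symmetric] b_def[symmetric] by linarith
  qed
  then have "(vnorm (transpose_mat (path_mat m n) *\<^sub>v v))\<^sup>2
      \<le> (\<Sum>c<n. 2 * (v $ c)\<^sup>2 + 2 * (if c = 0 then 0 else (v $ (c - 1))\<^sup>2) + (v $ c)\<^sup>2)"
    unfolding vnorm_path_mat_transpose[OF dvd v m] by (intro sum_mono) simp
  also have "\<dots> = 2 * (\<Sum>c<n. (v $ c)\<^sup>2) + 2 * (\<Sum>c<n. if c = 0 then 0 else (v $ (c - 1))\<^sup>2) + (\<Sum>c<n. (v $ c)\<^sup>2)"
    by (simp only: sum.distrib sum_distrib_left)
  also have "\<dots> \<le> 5 * (vnorm v)\<^sup>2"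
    using sum_shift_le[of "\<lambda>c. (v $ c)\<^sup>2" n] by (simp only: vnorm_sq[OF v]) simp
  finally show ?thesis .
qed

lemma not_dvd_block: "0 < j \<Longrightarrow> j < m \<Longrightarrow> \<not> m dvd i * m + j" for i j m :: nat
  by (simp add: nat_dvd_not_less)

text \<open>For \<open>m = 2\<close> the rows are orthonormal: a coupling row has entries of modulus
  sqrt (1/2), and the pinning entry sqrt (2/m) is 1. The condition number 1 obtained this way serves
  small \<kappa>, down to 1.\<close>

lemma vnorm_path_mat_transpose_two:
  assumes v: "v \<in> carrier_vec (T * 2)"
  shows "(vnorm (transpose_mat (path_mat 2 (T * 2)) *\<^sub>v v))\<^sup>2 = (vnorm v)\<^sup>2"
proof -
  have dvd: "2 dvd T * 2" by simp
  let ?w = "transpose_mat (path_mat 2 (T * 2)) *\<^sub>v v"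
  define h where "h c = (?w $ c)\<^sup>2 + (if 2 dvd Suc c then 2 / real 2 * (v $ c)\<^sup>2 else 0)" for c
  have block: "(\<Sum>c=i*2..<i*2+2. h c) = (\<Sum>c=i*2..<i*2+2. (v $ c)\<^sup>2)" if "i \<in> {..<T}" for i
  proof -
    from that have i: "i * 2 < T * 2" "Suc (i * 2) < T * 2" by auto
    have two: "{i*2..<i*2+2} = {i*2, Suc (i*2)}" by auto
    have "(sqrt 2)\<^sup>2 = (2 :: real)" by simp
    then have "h (i * 2) = (v $ (i * 2))\<^sup>2 / 2" "h (Suc (i * 2)) = (v $ (i * 2))\<^sup>2 / 2 + (v $ Suc (i * 2))\<^sup>2"
      unfolding h_def path_mat_transpose_mult(1)[OF dvd v i(1)] path_mat_transpose_mult(1)[OF dvd v i(2)]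
      by (simp_all add: row_fst_def row_snd_def power_mult_distrib power_divide real_sqrt_divide)
    then show ?thesis
      unfolding two by simp
  qed
  have "(vnorm ?w)\<^sup>2 = (\<Sum>c<T * 2. h c)"
    unfolding h_def by (rule vnorm_path_mat_transpose[OF dvd v]) simp
  also have "\<dots> = (\<Sum>i<T. \<Sum>c=i*2..<i*2+2. h c)"
    by (rule sum.nat_group[symmetric])
  also have "\<dots> = (\<Sum>i<T. \<Sum>c=i*2..<i*2+2. (v $ c)\<^sup>2)"
    by (rule sum.cong[OF refl block])
  also have "\<dots> = (\<Sum>c<T * 2. (v $ c)\<^sup>2)"
    by (rule sum.nat_group)
  finally show ?thesis
    unfolding vnorm_sq[OF v] .
qed

text \<open>A discrete Poincare inequality in each block. The first column gives the first entry up
  to sqrt m, and differences then propagate the bound to the right; the last entry is controlled by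
  its pinning row instead. Every squared entry is at most \<open>2 * m * Q\<close>, and a block has
  \<open>m\<close> entries.\<close>

lemma vnorm_path_mat_transpose_ge:
  assumes v: "v \<in> carrier_vec (T * m)" and m: "2 \<le> m"
  shows "(vnorm v)\<^sup>2 \<le> 2 * (real m)\<^sup>2 * (vnorm (transpose_mat (path_mat m (T * m)) *\<^sub>v v))\<^sup>2"
proof -
  have dvd: "m dvd T * m" and m0: "0 < m" using m by simp_all
  let ?w = "transpose_mat (path_mat m (T * m)) *\<^sub>v v"
  define h where "h c = (?w $ c)\<^sup>2 + (if m dvd Suc c then 2 / m * (v $ c)\<^sup>2 else 0)" for c
  have h_nonneg: "0 \<le> h c" for c
    by (simp add: h_def)
  have h_ge: "(?w $ c)\<^sup>2 \<le> h c" for c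
    by (simp add: h_def)
  have block: "(\<Sum>c=i*m..<i*m+m. (v $ c)\<^sup>2) \<le> 2 * (real m)\<^sup>2 * (\<Sum>c=i*m..<i*m+m. h c)" if i: "i < T" for i
  proof -
    define Q where "Q = (\<Sum>c=i*m..<i*m+m. h c)"
    have "(i + 1) * m \<le> T * m" using i by (intro mult_le_mono1) simp
    then have less: "i * m + j < T * m" if "j < m" for j
      using that by simp
    \<comment> \<open>The weight sqrt (1/m) at the block start costs \<open>m\<close>, each unit
      step along the path costs 1 more; \<open>j < m\<close> keeps the sum below
      \<open>2 * m\<close>.\<close>
    have step: "(v $ (i * m + j))\<^sup>2 \<le> (real m + real j) * (\<Sum>c=i*m..<i*m+Suc j. h c)" if "Suc j < m" for j
      using that
    proof (induction j)
      case 0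
      have nd: "\<not> m dvd Suc (i * m)"
        using not_dvd_block[of 1 m i] 0 by simp
      have c: "i * m < T * m" using less[of 0] m0 by simp
      have "?w $ (i * m) = sqrt (1 / m) * v $ (i * m)"
        unfolding path_mat_transpose_mult(1)[OF dvd v c] using nd by (simp add: row_fst_def)
      then have "(?w $ (i * m))\<^sup>2 = (v $ (i * m))\<^sup>2 / m"
        by (simp add: power_mult_distrib)
      then have "(v $ (i * m))\<^sup>2 = m * (?w $ (i * m))\<^sup>2"
        using m0 by simp
      also have "\<dots> \<le> m * h (i * m)"
        by (intro mult_left_mono h_ge) simp
      finally have "(v $ (i * m))\<^sup>2 \<le> m * h (i * m)" .
      then show ?case by simp
    next
      case (Suc j)
      define S where "S = (\<Sum>c=i*m..<i*m+Suc j. h c)"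
      define M where "M = real m + real j"
      define a where "a = v $ (i * m + j)"
      define d where "d = ?w $ (i * m + Suc j)"
      have M: "0 < M" using m0 by (simp add: M_def)
      have nd: "\<not> m dvd i * m + Suc j" "\<not> m dvd Suc (i * m + Suc j)"
        using not_dvd_block[of "Suc j" m i] not_dvd_block[of "Suc (Suc j)" m i] Suc.prems by simp_all
      have c: "i * m + Suc j < T * m" using less[of "Suc j"] Suc.prems by simp
      have "d = v $ (i * m + Suc j) - a"
        unfolding d_def a_def path_mat_transpose_mult(1)[OF dvd v c]
        using nd by (simp add: row_fst_def row_snd_def)
      then have "(v $ (i * m + Suc j))\<^sup>2 = (d + a)\<^sup>2" by simp
      \<comment> \<open>Cauchy-Schwarz with weights 1 and \<open>M\<close>, which makes the constant
        grow additively rather than geometrically.\<close>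
      also have "\<dots> \<le> (M + 1) * (d\<^sup>2 + a\<^sup>2 / M)"
      proof -
        have "(M + 1) * (d\<^sup>2 + a\<^sup>2 / M) - (d + a)\<^sup>2 = (M * d - a)\<^sup>2 / M"
          using M by (simp add: power2_eq_square field_simps)
        moreover have "0 \<le> (M * d - a)\<^sup>2 / M" using M by simp
        ultimately show ?thesis by linarith
      qed
      also have "\<dots> \<le> (M + 1) * (h (i * m + Suc j) + S)"
      proof (intro mult_left_mono add_mono)
        show "d\<^sup>2 \<le> h (i * m + Suc j)"
          unfolding d_def by (rule h_ge)
        have "a\<^sup>2 \<le> M * S"
          using Suc unfolding a_def S_def M_def by simp
        then show "a\<^sup>2 / M \<le> S"
          using M by (simp add: field_simps)
      qed (use M in simp)
      also have "\<dots> = (real m + real (Suc j)) * (\<Sum>c=i*m..<i*m+Suc (Suc j). h c)"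
        by (simp add: M_def S_def add_ac)
      finally show ?case .
    qed
    have "(v $ c)\<^sup>2 \<le> 2 * m * Q" if "c \<in> {i*m..<i*m+m}" for c
    proof -
      define j where "j = c - i * m"
      have c: "c = i * m + j" and j: "j < m" using that by (auto simp: j_def)
      show ?thesis
      proof (cases "Suc j < m")
        case True
        have "(\<Sum>c=i*m..<i*m+Suc j. h c) \<le> Q"
          unfolding Q_def using True h_nonneg by (intro sum_mono2) auto
        then have "(real m + real j) * (\<Sum>c=i*m..<i*m+Suc j. h c) \<le> (2 * m) * Q"
          using j sum_nonneg[of "{i*m..<i*m+Suc j}" h] h_nonneg by (intro mult_mono) simp_all
        with step[OF True] show ?thesis
          unfolding c by linarith
      next
        case False
        then have "Suc c = (i + 1) * m" using c j by simp
        then have "m dvd Suc c" by (metis dvd_triv_right)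
        then have "2 / m * (v $ c)\<^sup>2 \<le> h c" by (simp add: h_def)
        also have "h c \<le> Q"
          unfolding Q_def using that h_nonneg by (intro member_le_sum) auto
        finally have "(v $ c)\<^sup>2 \<le> m / 2 * Q"
          using m0 by (simp add: field_simps)
        also have "\<dots> \<le> 2 * m * Q"
          using h_nonneg by (intro mult_right_mono) (auto simp: Q_def intro!: sum_nonneg)
        finally show ?thesis .
      qed
    qed
    then have "(\<Sum>c=i*m..<i*m+m. (v $ c)\<^sup>2) \<le> (\<Sum>c=i*m..<i*m+m. 2 * m * Q)"
      by (intro sum_mono)
    then show ?thesis
      unfolding Q_def[symmetric] by (simp add: power2_eq_square mult_ac)
  qed
  have "(vnorm v)\<^sup>2 = (\<Sum>i<T. \<Sum>c=i*m..<i*m+m. (v $ c)\<^sup>2)"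
    unfolding vnorm_sq[OF v] by (rule sum.nat_group[symmetric])
  also have "\<dots> \<le> (\<Sum>i<T. 2 * (real m)\<^sup>2 * (\<Sum>c=i*m..<i*m+m. h c))"
    using block by (intro sum_mono) simp
  also have "\<dots> = 2 * (real m)\<^sup>2 * (\<Sum>i<T. \<Sum>c=i*m..<i*m+m. h c)"
    by (rule sum_distrib_left[symmetric])
  also have "(\<Sum>i<T. \<Sum>c=i*m..<i*m+m. h c) = (\<Sum>c<T * m. h c)"
    by (rule sum.nat_group)
  also have "\<dots> = (vnorm ?w)\<^sup>2"
    unfolding h_def by (rule vnorm_path_mat_transpose[OF dvd v m0, symmetric])
  finally show ?thesis .
qed

lemma condition_number_path_mat:
  assumes "0 < T" "2 \<le> m" "1 \<le> \<kappa>" "m = 2 \<or> 4 * real m \<le> \<kappa>"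
  shows "condition_number_le (path_mat m (T * m)) \<kappa>"
proof -
  have ev: "eigenvector (path_mat m (T * m) * transpose_mat (path_mat m (T * m))) (unit_vec (T * m) (m - 1)) (2 / m)"
    using assms by (intro eigenvector_path_mat) auto
  note rule = condition_number_leI[OF path_mat_carrier _ _ _ _ _ ev]
  show ?thesis
  proof (cases "m = 2")
    case True
    show ?thesis
      by (rule rule[where \<alpha> = 1 and \<beta> = 1]) (use assms True vnorm_path_mat_transpose_two in auto)
  next
    case False
    show ?thesis
    proof (rule rule[where \<alpha> = "1 / (2 * (real m)\<^sup>2)" and \<beta> = 5])
      \<comment> \<open>The ratio is sqrt 10 times \<open>m\<close>, and 10 \<le> 16.\<close>
      have "sqrt (5 / (1 / (2 * (real m)\<^sup>2))) \<le> sqrt ((4 * real m)\<^sup>2)"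
        by (intro real_sqrt_le_mono) (simp add: power_mult_distrib)
      also have "\<dots> \<le> \<kappa>"
        using False assms(4) unfolding real_sqrt_abs by simp
      finally show "sqrt (5 / (1 / (2 * (real m)\<^sup>2))) \<le> \<kappa>" .
    next
      fix v :: "real vec" assume v: "v \<in> carrier_vec (T * m)"
      show "1 / (2 * (real m)\<^sup>2) * (vnorm v)\<^sup>2 \<le> (vnorm (transpose_mat (path_mat m (T * m)) *\<^sub>v v))\<^sup>2"
        using vnorm_path_mat_transpose_ge[OF v assms(2)] assms(2) by (simp add: field_simps)
      show "(vnorm (transpose_mat (path_mat m (T * m)) *\<^sub>v v))\<^sup>2 \<le> 5 * (vnorm v)\<^sup>2"
        using v assms(2) by (intro vnorm_path_mat_transpose_le) auto
    qed (use assms in auto)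
  qed
qed

section \<open>Projection onto the kernel\<close>

lemma path_weight_row:
  assumes "\<not> m dvd Suc r"
  shows "row_fst m r * path_weight m r = row_snd m r * path_weight m (Suc r)"
  using assms by (cases "m dvd r"; cases "m dvd Suc (Suc r)") (simp_all add: row_fst_def row_snd_def path_weight_def)

lemma path_mat_kernel:
  assumes m: "2 \<le> m" and u: "u \<in> carrier_vec (2 * (T * m))"
    and ker: "path_mat m (T * m) *\<^sub>v u = 0\<^sub>v (T * m)"
  shows "i < T \<Longrightarrow> j < m \<Longrightarrow> u $ (i * m + j) = path_weight m (i * m + j) * u $ (i * m)"
    and "r < T * m \<Longrightarrow> m dvd Suc r \<Longrightarrow> u $ (T * m + r) = 0"
proof -
  have dvd: "m dvd T * m" by simp
  have eq: "(path_mat m (T * m) *\<^sub>v u) $ r = 0" if "r < T * m" for r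
    using that unfolding ker by simp
  show "u $ (T * m + r) = 0" if "r < T * m" "m dvd Suc r"
    using eq[OF that(1)] m that(2) unfolding path_mat_mult[OF dvd u that(1)] by simp
  show "u $ (i * m + j) = path_weight m (i * m + j) * u $ (i * m)" if i: "i < T" and "j < m"
    using that(2)
  proof (induction j)
    case 0
    then show ?case by (simp add: path_weight_def)
  next
    case (Suc j)
    have "(i + 1) * m \<le> T * m" using i by (intro mult_le_mono1) simp
    then have r: "i * m + j < T * m" using Suc.prems by simp
    have nd: "\<not> m dvd Suc (i * m + j)"
      using not_dvd_block[of "Suc j" m i] Suc.prems by simp
    have "row_snd m (i * m + j) * u $ (i * m + Suc j) = row_fst m (i * m + j) * u $ (i * m + j)"
      using eq[OF r] nd unfolding path_mat_mult[OF dvd u r] by simp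
    also have "\<dots> = row_snd m (i * m + j) * (path_weight m (i * m + Suc j) * u $ (i * m))"
      using Suc path_weight_row[OF nd] by simp
    finally show ?case
      using row_bounds(3)[of m "i * m + j"] m by simp
  qed
qed

text \<open>Coefficient of the orthogonal projection of block \<open>i\<close> onto the line spanned
  by its weights.\<close>

definition block_coeff :: "nat \<Rightarrow> real vec \<Rightarrow> nat \<Rightarrow> real" where
  "block_coeff m x i =
     (\<Sum>c=i*m..<i*m+m. path_weight m c * x $ c) / (\<Sum>c=i*m..<i*m+m. (path_weight m c)\<^sup>2)"

text \<open>Blocks are projected separately. Extra coordinates outside the pinned ones belong to
  zero columns of \<open>path_mat\<close>, so they are left unchanged.\<close>

definition kernel_proj :: "nat \<Rightarrow> nat \<Rightarrow> real vec \<Rightarrow> real vec" where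
  "kernel_proj m n x = vec (2 * n) (\<lambda>c.
     if c < n then path_weight m c * block_coeff m x (c div m)
     else if m dvd Suc (c - n) then 0 else x $ c)"

lemma path_weight_pos: "0 < m \<Longrightarrow> 0 < path_weight m c"
  by (simp add: path_weight_def)

lemma sum_path_weight_sq_pos:
  assumes "0 < m"
  shows "0 < (\<Sum>c=i*m..<i*m+m. (path_weight m c)\<^sup>2)"
proof (rule sum_pos)
  fix c
  show "0 < (path_weight m c)\<^sup>2"
    using path_weight_pos[OF assms, of c] by simp
qed (use assms in simp_all)

text \<open>The two ends contribute 1 each, and fewer than \<open>m\<close> inner entries contribute
  1/m each.\<close>

lemma sum_path_weight_sq_le:
  assumes m: "0 < m"
  shows "(\<Sum>c=i*m..<i*m+m. (path_weight m c)\<^sup>2) \<le> 3"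
proof -
  have "(\<Sum>c=i*m..<i*m+m. (path_weight m c)\<^sup>2)
      \<le> (\<Sum>c=i*m..<i*m+m. 1 / m + (if c = i * m then 1 else 0) + (if c = i * m + (m - 1) then 1 else 0))"
  proof (rule sum_mono)
    fix c assume c: "c \<in> {i*m..<i*m+m}"
    define j where "j = c - i * m"
    have j: "c = i * m + j" "j < m" using c by (auto simp: j_def)
    show "(path_weight m c)\<^sup>2 \<le> 1 / m + (if c = i * m then 1 else 0) + (if c = i * m + (m - 1) then 1 else 0)"
    proof (cases "j = 0 \<or> j = m - 1")
      case True
      have "(path_weight m c)\<^sup>2 \<le> 1"
        using m by (simp add: path_weight_def)
      moreover have "0 \<le> 1 / real m" by simp
      moreover have "1 \<le> (if c = i * m then 1 else 0) + (if c = i * m + (m - 1) then 1 else (0 :: real))"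
        using True j(1) by auto
      ultimately show ?thesis by linarith
    next
      case False
      then have "0 < j" "Suc j < m" using j(2) by linarith+
      then have "\<not> m dvd c" "\<not> m dvd Suc c"
        using not_dvd_block[of j m i] not_dvd_block[of "Suc j" m i] j by simp_all
      then show ?thesis by (simp add: path_weight_def)
    qed
  qed
  also have "\<dots> = 3"
    using m by (simp add: sum.distrib)
  finally show ?thesis .
qed

lemma div_block: "c \<in> {i*m..<i*m+m} \<Longrightarrow> c div m = i" for c i m :: nat
proof (rule div_nat_eqI)
  assume c: "c \<in> {i*m..<i*m+m}"
  show "m * i \<le> c" "c < m * Suc i"
    using c unfolding mult_Suc_right mult.commute[of m i] by simp_all
qed

lemma kernel_proj_carrier: "kernel_proj m n x \<in> carrier_vec (2 * n)"
  by (simp add: kernel_proj_def)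

lemma div_Suc_of_not_dvd: "\<not> m dvd Suc r \<Longrightarrow> Suc r div m = r div m" for m r :: nat
  by (simp add: div_Suc dvd_eq_mod_eq_0)

lemma path_mat_kernel_proj:
  assumes "m dvd n"
  shows "path_mat m n *\<^sub>v kernel_proj m n x = 0\<^sub>v n"
proof (rule eq_vecI)
  fix r assume "r < dim_vec (0\<^sub>v n :: real vec)"
  then have r: "r < n" by simp
  show "(path_mat m n *\<^sub>v kernel_proj m n x) $ r = 0\<^sub>v n $ r"
  proof (cases "m dvd Suc r")
    case True
    then show ?thesis
      unfolding path_mat_mult[OF assms kernel_proj_carrier r] using r by (simp add: kernel_proj_def)
  next
    case False
    have "Suc r < n" using Suc_less_of_not_dvd[OF assms False r] .
    then show ?thesis
      unfolding path_mat_mult[OF assms kernel_proj_carrier r]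
      using r False path_weight_row[OF False] by (simp add: kernel_proj_def div_Suc_of_not_dvd)
  qed
qed (simp add: path_mat_def)

lemma kernel_proj_block_orthogonal:
  assumes m: "0 < m" and i: "i < T"
  shows "(\<Sum>c=i*m..<i*m+m. path_weight m c * (x $ c - kernel_proj m (T * m) x $ c)) = 0"
proof -
  have "(i + 1) * m \<le> T * m" using i by (intro mult_le_mono1) simp
  then have less: "c < T * m" if "c \<in> {i*m..<i*m+m}" for c
    using that by simp
  have "(\<Sum>c=i*m..<i*m+m. path_weight m c * (x $ c - kernel_proj m (T * m) x $ c))
      = (\<Sum>c=i*m..<i*m+m. path_weight m c * x $ c - block_coeff m x i * (path_weight m c)\<^sup>2)"
  proof (intro sum.cong refl)
    fix c assume c: "c \<in> {i*m..<i*m+m}"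
    have "kernel_proj m (T * m) x $ c = path_weight m c * block_coeff m x i"
      using less[OF c] div_block[OF c] by (simp add: kernel_proj_def)
    then show "path_weight m c * (x $ c - kernel_proj m (T * m) x $ c)
        = path_weight m c * x $ c - block_coeff m x i * (path_weight m c)\<^sup>2"
      by (simp add: power2_eq_square right_diff_distrib)
  qed
  also have "\<dots> = 0"
    unfolding sum_subtractf sum_distrib_left[symmetric]
    using sum_path_weight_sq_pos[OF m, of i] by (simp add: block_coeff_def)
  finally show ?thesis .
qed

text \<open>A kernel vector is a multiple of the weights on each block, where the normal equation
  applies. On an extra coordinate either the kernel vector is pinned to zero or the projection
  changes nothing.\<close>

lemma kernel_proj_orthogonal:
  assumes m: "2 \<le> m" and x: "x \<in> carrier_vec (2 * (T * m))" and u: "u \<in> carrier_vec (2 * (T * m))"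
    and ker: "path_mat m (T * m) *\<^sub>v u = 0\<^sub>v (T * m)"
  shows "(x - kernel_proj m (T * m) x) \<bullet> u = 0"
proof -
  let ?p = "kernel_proj m (T * m) x"
  have "(x - ?p) \<bullet> u = (\<Sum>c<2 * (T * m). (x $ c - ?p $ c) * u $ c)"
    unfolding scalar_prod_sum[OF minus_carrier_vec[OF x kernel_proj_carrier] u]
    using kernel_proj_carrier[of m "T * m" x] by (intro sum.cong) auto
  also have "\<dots> = (\<Sum>c<T * m. (x $ c - ?p $ c) * u $ c) + (\<Sum>r<T * m. (x $ (T * m + r) - ?p $ (T * m + r)) * u $ (T * m + r))"
    by (rule sum_lessThan_double)
  also have "(\<Sum>r<T * m. (x $ (T * m + r) - ?p $ (T * m + r)) * u $ (T * m + r)) = 0"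
  proof (rule sum.neutral, rule ballI)
    fix r assume "r \<in> {..<T * m}"
    then show "(x $ (T * m + r) - ?p $ (T * m + r)) * u $ (T * m + r) = 0"
      using path_mat_kernel(2)[OF m u ker, of r] by (cases "m dvd Suc r") (simp_all add: kernel_proj_def)
  qed
  also have "(\<Sum>c<T * m. (x $ c - ?p $ c) * u $ c) = (\<Sum>i<T. \<Sum>c=i*m..<i*m+m. (x $ c - ?p $ c) * u $ c)"
    by (rule sum.nat_group[symmetric])
  also have "\<dots> = 0"
  proof (rule sum.neutral, rule ballI)
    fix i assume "i \<in> {..<T}"
    then have i: "i < T" by simp
    have "(\<Sum>c=i*m..<i*m+m. (x $ c - ?p $ c) * u $ c)
        = (\<Sum>c=i*m..<i*m+m. u $ (i * m) * (path_weight m c * (x $ c - ?p $ c)))"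
    proof (intro sum.cong refl)
      fix c assume c: "c \<in> {i*m..<i*m+m}"
      define j where "j = c - i * m"
      have j: "c = i * m + j" "j < m" using c by (auto simp: j_def)
      show "(x $ c - ?p $ c) * u $ c = u $ (i * m) * (path_weight m c * (x $ c - ?p $ c))"
        using path_mat_kernel(1)[OF m u ker i j(2)] unfolding j(1)[symmetric] by simp
    qed
    also have "\<dots> = u $ (i * m) * (\<Sum>c=i*m..<i*m+m. path_weight m c * (x $ c - ?p $ c))"
      by (rule sum_distrib_left[symmetric])
    also have "\<dots> = 0"
      using kernel_proj_block_orthogonal[OF _ i, of m x] m by simp
    finally show "(\<Sum>c=i*m..<i*m+m. (x $ c - ?p $ c) * u $ c) = 0" .
  qed
  finally show ?thesis by simp
qed

section \<open>The proximal map of an indicator as an orthogonal projection\<close>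

lemma vnorm_sq_pythagoras:
  assumes x: "x \<in> carrier_vec n" and p: "p \<in> carrier_vec n" and u: "u \<in> carrier_vec n"
    and orth: "(x - p) \<bullet> (p - u) = 0"
  shows "(vnorm (x - u))\<^sup>2 = (vnorm (x - p))\<^sup>2 + (vnorm (p - u))\<^sup>2"
proof -
  have "0 = 2 * (\<Sum>i<n. (x $ i - p $ i) * (p $ i - u $ i))"
    using orth unfolding scalar_prod_sum[OF minus_carrier_vec[OF x p] minus_carrier_vec[OF p u]]
    using x p u by simp
  then have "(vnorm (x - p))\<^sup>2 + (vnorm (p - u))\<^sup>2 =
      (\<Sum>i<n. (x $ i - p $ i)\<^sup>2) + (\<Sum>i<n. (p $ i - u $ i)\<^sup>2) + 2 * (\<Sum>i<n. (x $ i - p $ i) * (p $ i - u $ i))"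
    using x p u by (simp add: vnorm_sq[of _ n])
  also have "\<dots> = (\<Sum>i<n. (x $ i - u $ i)\<^sup>2)"
    unfolding sum_distrib_left sum.distrib[symmetric]
    by (intro sum.cong refl) (simp add: power2_eq_square algebra_simps)
  finally show ?thesis
    using x u by (simp add: vnorm_sq[of _ n])
qed

text \<open>Pythagoras makes \<open>p\<close> the strict minimiser on \<open>K\<close>, and points
  outside \<open>K\<close> have infinite value. Strictness matters because \<open>arg_min\<close> is
  an arbitrary choice among minimisers.\<close>

lemma prox_indicator:
  assumes x: "x \<in> carrier_vec n" and p: "p \<in> carrier_vec n" "p \<in> K"
    and orth: "\<And>u. u \<in> carrier_vec n \<Longrightarrow> u \<in> K \<Longrightarrow> (x - p) \<bullet> (p - u) = 0"
    and g: "\<And>u. u \<in> carrier_vec n \<Longrightarrow> g u = (if u \<in> K then 0 else \<infinity>)"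
  shows "prox n g x = p"
proof -
  define F where "F u = g u + ereal ((vnorm (x - u))\<^sup>2 / 2)" for u
  have Fp: "F p = ereal ((vnorm (x - p))\<^sup>2 / 2)"
    using p g by (simp add: F_def)
  have le: "F p \<le> F u" if u: "u \<in> carrier_vec n" for u
  proof (cases "u \<in> K")
    case True
    then show ?thesis
      unfolding Fp using vnorm_sq_pythagoras[OF x p(1) u orth[OF u True]] g[OF u] by (simp add: F_def)
  qed (use g[OF u] in \<open>simp add: F_def\<close>)
  have uniq: "q = p" if q: "q \<in> carrier_vec n" and "F q \<le> F p" for q
  proof -
    have "q \<in> K"
      using that(2) g[OF q] unfolding Fp by (cases "q \<in> K") (simp_all add: F_def)
    then have "(vnorm (x - q))\<^sup>2 = (vnorm (x - p))\<^sup>2 + (vnorm (p - q))\<^sup>2"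
      by (intro vnorm_sq_pythagoras[OF x p(1) q] orth q)
    moreover have "(vnorm (x - q))\<^sup>2 \<le> (vnorm (x - p))\<^sup>2"
      using that(2) g[OF q] \<open>q \<in> K\<close> unfolding Fp by (simp add: F_def)
    ultimately have "vnorm (p - q) = 0" by simp
    then have eq: "p - q = 0\<^sub>v n"
      using vnorm_eq_0_iff[OF minus_carrier_vec[OF p(1) q]] by simp
    show "q = p"
    proof (rule eq_vecI)
      fix i assume "i < dim_vec p"
      then have i: "i < n" using p by simp
      have "(p - q) $ i = 0" using eq i by simp
      then show "q $ i = p $ i" using i p q by simp
    qed (use p q in simp)
  qed
  have "is_arg_min F (\<lambda>u. u \<in> carrier_vec n) (arg_min F (\<lambda>u. u \<in> carrier_vec n))"
    unfolding arg_min_def by (rule someI[of _ p]) (use p le in \<open>auto simp: is_arg_min_def not_less\<close>)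
  then have "arg_min F (\<lambda>u. u \<in> carrier_vec n) = p"
    using p(1) by (intro uniq) (auto simp: is_arg_min_def not_less)
  then show ?thesis
    by (simp add: prox_def F_def[abs_def])
qed

section \<open>The hard instance\<close>

definition hard_instance :: "nat \<Rightarrow> nat \<Rightarrow> real \<Rightarrow> real \<Rightarrow> problem" where
  "hard_instance m T L s =
    \<lparr>xdim = 2 * (T * m), ydim = T * m, fobj = chain_objective m (T * m) L s,
     hobj = (\<lambda>y. if y = 0\<^sub>v (T * m) then 0 else \<infinity>), Amat = path_mat m (T * m), bvec = 0\<^sub>v (T * m)\<rparr>"

lemma hard_instance_simps [simp]:
  "xdim (hard_instance m T L s) = 2 * (T * m)"
  "ydim (hard_instance m T L s) = T * m"
  "fobj (hard_instance m T L s) = chain_objective m (T * m) L s"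
  "hobj (hard_instance m T L s) = (\<lambda>y. if y = 0\<^sub>v (T * m) then 0 else \<infinity>)"
  "Amat (hard_instance m T L s) = path_mat m (T * m)"
  "bvec (hard_instance m T L s) = 0\<^sub>v (T * m)"
  by (simp_all add: hard_instance_def)

lemma residual_hard_instance:
  "residual (hard_instance m T L s) x = path_mat m (T * m) *\<^sub>v x"
  by (rule eq_vecI) (simp_all add: residual_def path_mat_def)

lemma linear_equality_hard_instance: "linear_equality_constrained (hard_instance m T L s)"
  by (simp add: linear_equality_constrained_def)

lemma closed_fun_indicator_zero: "closed_fun n (\<lambda>y. if y = 0\<^sub>v n then 0 else \<infinity>)"
  unfolding closed_fun_def
proof (intro ballI allI impI)
  fix x :: "real vec" and c :: ereal
  assume x: "x \<in> carrier_vec n" and c: "c < (if x = 0\<^sub>v n then 0 else \<infinity>)"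
  show "\<exists>d>0. \<forall>y\<in>carrier_vec n. vnorm (y - x) < d \<longrightarrow> c < (if y = 0\<^sub>v n then 0 else \<infinity>)"
  proof (cases "x = 0\<^sub>v n")
    case True
    then have "c < 0" using c by simp
    then have "c < (if y = 0\<^sub>v n then 0 else \<infinity>)" for y :: "real vec"
      using less_trans[of c 0 \<infinity>] by simp
    then show ?thesis by (intro exI[of _ 1]) simp
  next
    case False
    then have "c < \<infinity>" using c by simp
    have "vnorm x \<noteq> 0" using False vnorm_eq_0_iff[OF x] by simp
    then have pos: "0 < vnorm x" using vnorm_nonneg[of x] by linarith
    have "c < (if y = 0\<^sub>v n then 0 else \<infinity>)" if y: "y \<in> carrier_vec n" "vnorm (y - x) < vnorm x" for y
    proof -
      have "y \<noteq> 0\<^sub>v n"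
      proof
        assume "y = 0\<^sub>v n"
        then have "vnorm (y - x) = vnorm x"
          using x vnorm_minus_commute[of x n y] by simp
        then show False using y(2) by simp
      qed
      then show ?thesis using \<open>c < \<infinity>\<close> by simp
    qed
    then show ?thesis using pos by blast
  qed
qed

lemma convex_fun_indicator_zero: "convex_fun n (\<lambda>y. if y = 0\<^sub>v n then 0 else \<infinity>)"
  unfolding convex_fun_def
proof (intro ballI allI impI)
  fix x y :: "real vec" and t :: real
  assume xy: "x \<in> carrier_vec n" "y \<in> carrier_vec n" and t: "0 < t \<and> t < 1"
  show "(if (1 - t) \<cdot>\<^sub>v x + t \<cdot>\<^sub>v y = 0\<^sub>v n then 0 else \<infinity>)
      \<le> ereal (1 - t) * (if x = 0\<^sub>v n then 0 else \<infinity>) + ereal t * (if y = 0\<^sub>v n then 0 else \<infinity>)"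
  proof (cases "x = 0\<^sub>v n \<and> y = 0\<^sub>v n")
    case True
    then have "(1 - t) \<cdot>\<^sub>v x + t \<cdot>\<^sub>v y = 0\<^sub>v n" by auto
    then show ?thesis using True by simp
  next
    case False
    then have eq: "ereal (1 - t) * (if x = 0\<^sub>v n then 0 else \<infinity>) + ereal t * (if y = 0\<^sub>v n then 0 else \<infinity>) = \<infinity>"
      using t by auto
    show ?thesis unfolding eq by simp
  qed
qed

text \<open>With \<open>bvec\<close> zero the origin is feasible, and its value is at most 0. The
  lower bound by \<open>T\<close> links, scaled by \<open>L * s\<^sup>2 / 12\<close>, then bounds
  the gap.\<close>

lemma hard_instance_in_class:
  assumes m: "2 \<le> m" "m = 2 \<or> 4 * real m \<le> \<kappa>" and \<kappa>: "1 \<le> \<kappa>" and T: "0 < T" and "0 < L" "0 < s"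
    and gap: "real T * (L * s\<^sup>2 / 12) \<le> \<Delta>"
  shows "well_formed (hard_instance m T L s)" "hard_instance m T L s \<in> F_NC L \<Delta> \<kappa>"
proof -
  let ?P = "hard_instance m T L s" and ?n = "T * m"
  have smooth: "smooth (2 * ?n) L (chain_objective m ?n L s)"
    using assms by (intro smooth_chain_objective) auto
  have proper: "proper_fun ?n (\<lambda>y. if y = 0\<^sub>v ?n then 0 else \<infinity>)"
    unfolding proper_fun_def by (auto intro!: bexI[of _ "0\<^sub>v ?n"])
  show wf: "well_formed ?P"
    unfolding well_formed_def
    using T m(1) \<open>0 < L\<close> smooth proper path_mat_carrier closed_fun_indicator_zero convex_fun_indicator_zero
    by auto
  have A0: "path_mat m ?n *\<^sub>v 0\<^sub>v (2 * ?n) = 0\<^sub>v ?n"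
    by (rule eq_vecI) (simp_all add: path_mat_def scalar_prod_def)
  have lower: "- (real T * (L * s\<^sup>2 / 12)) \<le> chain_objective m ?n L s x" for x
  proof -
    have "L * s\<^sup>2 / 12 * (- real T) \<le> L * s\<^sup>2 / 12 * chain m ?n (\<lambda>c. x $ c / s)"
      using assms by (intro mult_left_mono chain_ge) auto
    then show ?thesis by (simp add: chain_objective_def mult_ac)
  qed
  have zero: "chain_objective m ?n L s (0\<^sub>v (2 * ?n)) \<le> 0"
  proof -
    have "chain m ?n (\<lambda>c. 0\<^sub>v (2 * ?n) $ c / s) = chain m ?n (\<lambda>_. 0)"
      unfolding chain_def by (intro sum.cong) (auto simp: prev_coord_def)
    then show ?thesis
      using chain_zero_le[of m ?n] assms by (simp add: chain_objective_def mult_nonneg_nonpos)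
  qed
  have obj0: "total_obj ?P (0\<^sub>v (2 * ?n)) = ereal (chain_objective m ?n L s (0\<^sub>v (2 * ?n)))"
    by (simp add: total_obj_def residual_hard_instance A0)
  have "ereal (- (real T * (L * s\<^sup>2 / 12))) \<le> (INF x\<in>carrier_vec (2 * ?n). total_obj ?P x)"
  proof (rule INF_greatest)
    fix x :: "real vec"
    show "ereal (- (real T * (L * s\<^sup>2 / 12))) \<le> total_obj ?P x"
      using lower[of x] by (simp add: total_obj_def)
  qed
  then have "total_obj ?P (0\<^sub>v (2 * ?n)) - (INF x\<in>carrier_vec (2 * ?n). total_obj ?P x)
      \<le> ereal 0 - ereal (- (real T * (L * s\<^sup>2 / 12)))"
    unfolding obj0 using zero by (intro ereal_minus_mono) auto
  also have "\<dots> \<le> ereal \<Delta>" using gap by simp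
  finally show "?P \<in> F_NC L \<Delta> \<kappa>"
    using wf smooth obj0 condition_number_path_mat[OF T m(1) \<kappa> m(2)] by (simp add: F_NC_def)
qed

text \<open>From \<open>Suc k\<close> on, a coordinate and its predecessor are both zero, so the
  zero-chain property applies.\<close>

lemma chain_gradient_support:
  assumes u: "\<And>c. k \<le> c \<Longrightarrow> c < N \<Longrightarrow> u $ c = 0" and "n \<le> N" and c: "Suc k \<le> c" "c < N"
  shows "chain_gradient m n N L s u $ c = 0"
proof (cases "c < n")
  case True
  have "u $ c = 0" "u $ (c - 1) = 0" using u c by auto
  then show ?thesis
    using True c by (simp add: chain_gradient_def chain_deriv_def prev_coord_def link_fst_zero link_snd_zero)
qed (use c in \<open>simp add: chain_gradient_def\<close>)

text \<open>Row \<open>r\<close> reads coordinates \<open>r\<close> and \<open>r + 1\<close>, or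
  only \<open>n + r\<close>, so \<open>A u\<close> vanishes from row \<open>k\<close> on. The
  transpose reads rows \<open>c\<close> and \<open>c - 1\<close>, so one coordinate is gained. Extra
  coordinates interact only with themselves and offer no shortcut.\<close>

lemma path_mat_normal_support:
  assumes "m dvd n" and u: "u \<in> carrier_vec (2 * n)" "\<And>c. k \<le> c \<Longrightarrow> c < 2 * n \<Longrightarrow> u $ c = 0"
    and c: "Suc k \<le> c" "c < 2 * n"
  shows "(transpose_mat (path_mat m n) *\<^sub>v (path_mat m n *\<^sub>v u)) $ c = 0"
proof -
  let ?v = "path_mat m n *\<^sub>v u"
  have v: "?v \<in> carrier_vec n"
    using path_mat_carrier u(1) by (rule mult_mat_vec_carrier)
  have v0: "?v $ r = 0" if "k \<le> r" "r < n" for r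
    unfolding path_mat_mult[OF assms(1) u(1) that(2)] using u(2) that Suc_less_of_not_dvd[OF assms(1) _ that(2)] by simp
  show ?thesis
  proof (cases "c < n")
    case True
    then show ?thesis
      unfolding path_mat_transpose_mult(1)[OF assms(1) v True] using v0 c by simp
  next
    case False
    then obtain r where r: "c = n + r" "r < n" using c by (metis add_less_cancel_left le_Suc_ex mult_2 not_less)
    have "?v $ r = 0" if "m dvd Suc r"
      using that u(2)[of "n + r"] r c unfolding path_mat_mult[OF assms(1) u(1) r(2)] by simp
    then show ?thesis
      unfolding r(1) path_mat_transpose_mult(2)[OF assms(1) v r(2)] by simp
  qed
qed

text \<open>Coordinate subspaces are closed under spans, and every generator built from step
  \<open>i\<close> lies in \<open>Z (Suc i)\<close>. The induction is strong because all earlier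
  spaces supply generators.\<close>

lemma equality_span_run_support:
  assumes run: "equality_span_run (hard_instance m T L s) x" and "0 < L" "0 < s"
  shows "x k \<in> carrier_vec (2 * (T * m))" "k \<le> c \<Longrightarrow> c < 2 * (T * m) \<Longrightarrow> x k $ c = 0"
proof -
  let ?n = "T * m" and ?P = "hard_instance m T L s"
  let ?N = "2 * ?n"
  define Z where "Z k = {u \<in> carrier_vec ?N. \<forall>c. k \<le> c \<longrightarrow> c < ?N \<longrightarrow> u $ c = (0 :: real)}" for k
  have span_Z: "vspan ?N S \<subseteq> Z k" if "S \<subseteq> Z k" for S k
  proof
    fix u assume u: "u \<in> vspan ?N S"
    have S: "S \<subseteq> carrier_vec ?N" using that by (auto simp: Z_def)
    have "u $ c = 0" if "k \<le> c" "c < ?N" for c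
      using S _ that(2) u by (rule vspan_coordinate_zero) (use \<open>S \<subseteq> Z k\<close> that in \<open>auto simp: Z_def\<close>)
    then show "u \<in> Z k" using vspan_carrier[OF S u] by (simp add: Z_def)
  qed
  have Z_mono: "Z i \<subseteq> Z k" if "i \<le> k" for i k
    using that by (auto simp: Z_def)
  from run obtain Sx where x0: "x 0 = 0\<^sub>v ?N" and S0: "Sx 0 = vspan ?N {x 0}"
    and S: "\<And>k. Sx (Suc k) = vspan ?N
               ({x i | i. i \<le> k}
                \<union> {gradient ?N (chain_objective m ?n L s) u | i u. i \<le> k \<and> u \<in> Sx i}
                \<union> {transpose_mat (path_mat m ?n) *\<^sub>v (path_mat m ?n *\<^sub>v u) | i u. i \<le> k \<and> u \<in> Sx i})"
    and xS: "\<And>k. x k \<in> Sx k"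
    unfolding equality_span_run_def residual_hard_instance hard_instance_simps by blast
  have "Sx k \<subseteq> Z k" for k
  proof (induction k rule: less_induct)
    case (less k)
    show ?case
    proof (cases k)
      case 0
      show ?thesis
        unfolding 0 S0 by (rule span_Z) (simp add: x0 Z_def)
    next
      case (Suc j)
      have IH: "Sx i \<subseteq> Z i" if "i \<le> j" for i
        using less[of i] that Suc by simp
      show ?thesis
        unfolding Suc S
      proof (intro span_Z Un_least subsetI)
        fix v assume "v \<in> {x i | i. i \<le> j}"
        then obtain i where "v = x i" "i \<le> j" by auto
        then show "v \<in> Z (Suc j)"
          using IH[of i] xS[of i] Z_mono[of i "Suc j"] by auto
      next
        fix v assume "v \<in> {gradient ?N (chain_objective m ?n L s) u | i u. i \<le> j \<and> u \<in> Sx i}"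
        then obtain i u where v: "v = gradient ?N (chain_objective m ?n L s) u" "i \<le> j" "u \<in> Sx i" by auto
        then have u: "u \<in> Z i" using IH[of i] by auto
        then have "v = chain_gradient m ?n ?N L s u"
          unfolding v(1) using assms(2,3) by (intro gradient_chain_objective) (auto simp: Z_def)
        moreover have "chain_gradient m ?n ?N L s u \<in> Z (Suc i)"
          unfolding Z_def
        proof (intro CollectI conjI allI impI)
          show "chain_gradient m ?n ?N L s u \<in> carrier_vec ?N"
            by (simp add: chain_gradient_def)
          fix c assume "Suc i \<le> c" "c < ?N"
          then show "chain_gradient m ?n ?N L s u $ c = 0"
            using u by (intro chain_gradient_support[of i ?N u]) (simp_all add: Z_def)
        qed
        ultimately show "v \<in> Z (Suc j)"
          using Z_mono[of "Suc i" "Suc j"] v(2) by auto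
      next
        fix v assume "v \<in> {transpose_mat (path_mat m ?n) *\<^sub>v (path_mat m ?n *\<^sub>v u) | i u. i \<le> j \<and> u \<in> Sx i}"
        then obtain i u where v: "v = transpose_mat (path_mat m ?n) *\<^sub>v (path_mat m ?n *\<^sub>v u)" "i \<le> j" "u \<in> Sx i"
          by auto
        then have u: "u \<in> carrier_vec ?N" "\<And>c. i \<le> c \<Longrightarrow> c < ?N \<Longrightarrow> u $ c = 0"
          using IH[of i] by (auto simp: Z_def)
        have "v \<in> carrier_vec ?N"
          unfolding v(1) using path_mat_carrier[of m ?n] by (simp add: carrier_vecI)
        moreover have "v $ c = 0" if "Suc i \<le> c" "c < ?N" for c
          unfolding v(1) by (rule path_mat_normal_support[OF _ u that]) simp_all
        ultimately have "v \<in> Z (Suc i)" by (simp add: Z_def)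
        then show "v \<in> Z (Suc j)"
          using Z_mono[of "Suc i" "Suc j"] v(2) by auto
      qed
    qed
  qed
  then have "x k \<in> Z k" using xS[of k] by auto
  then show "x k \<in> carrier_vec ?N" "k \<le> c \<Longrightarrow> c < ?N \<Longrightarrow> x k $ c = 0"
    by (auto simp: Z_def)
qed

text \<open>Scaling by the positive factor \<open>1 / (2 * L)\<close> leaves an indicator unchanged,
  so the prox is the projection onto the kernel.\<close>

lemma SubOpt_hard_instance:
  assumes m: "2 \<le> m" and "0 < L" "0 < s" and x: "x \<in> carrier_vec (2 * (T * m))"
  shows "SubOpt_NC L (hard_instance m T L s) x = L * vnorm (x - kernel_proj m (T * m)
    (x - (1 / (2 * L)) \<cdot>\<^sub>v chain_gradient m (T * m) (2 * (T * m)) L s x))"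
proof -
  let ?n = "T * m" and ?N = "2 * (T * m)"
  define w where "w = x - (1 / (2 * L)) \<cdot>\<^sub>v chain_gradient m ?n ?N L s x"
  have w: "w \<in> carrier_vec ?N"
    using x by (simp add: w_def chain_gradient_def)
  have dvd: "m dvd ?n" by simp
  have "prox ?N (\<lambda>u. ereal (1 / (2 * L)) * (if path_mat m ?n *\<^sub>v u = 0\<^sub>v ?n then 0 else \<infinity>)) w = kernel_proj m ?n w"
  proof (rule prox_indicator[where K = "{u. path_mat m ?n *\<^sub>v u = 0\<^sub>v ?n}"])
    show "kernel_proj m ?n w \<in> {u. path_mat m ?n *\<^sub>v u = 0\<^sub>v ?n}"
      using path_mat_kernel_proj[OF dvd] by simp
    fix u assume u: "u \<in> carrier_vec ?N" "u \<in> {u. path_mat m ?n *\<^sub>v u = 0\<^sub>v ?n}"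
    have "(w - kernel_proj m ?n w) \<bullet> (kernel_proj m ?n w - u)
        = (w - kernel_proj m ?n w) \<bullet> kernel_proj m ?n w - (w - kernel_proj m ?n w) \<bullet> u"
      using w u kernel_proj_carrier[of m ?n w] by (intro scalar_prod_minus_distrib) auto
    also have "\<dots> = 0"
      using kernel_proj_orthogonal[OF m w kernel_proj_carrier path_mat_kernel_proj[OF dvd]]
        kernel_proj_orthogonal[OF m w u(1)] u(2) by simp
    finally show "(w - kernel_proj m ?n w) \<bullet> (kernel_proj m ?n w - u) = 0" .
  qed (use w kernel_proj_carrier \<open>0 < L\<close> in auto)
  moreover have "gradient ?N (chain_objective m ?n L s) x = chain_gradient m ?n ?N L s x"
    using assms by (intro gradient_chain_objective) auto
  ultimately show ?thesis
    by (simp add: SubOpt_NC_def residual_hard_instance w_def)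
qed

section \<open>The lower bound\<close>

text \<open>If the measure were at most \<epsilon>, then \<open>x\<close> would lie within
  \<open>\<eta>\<close> of the projection \<open>p\<close>, whose entries at both ends of block
  \<open>i\<close> equal \<open>Y i\<close>. The last coordinate being zero makes the last block
  small, so some block is the first that is not on, and its incoming link has a steep slope. The
  normal equation of the projection balances this slope against the weighted deviation
  \<open>x - p\<close>, which is too small.\<close>

lemma SubOpt_hard_instance_gt:
  assumes m: "2 \<le> m" and T: "0 < T" and "0 < L" "0 < \<epsilon>"
    and x: "x \<in> carrier_vec (2 * (T * m))" and last: "x $ (T * m - 1) = 0"
  shows "\<epsilon> < SubOpt_NC L (hard_instance m T L (8000 * (\<epsilon> / L))) x"
proof (rule ccontr)
  define n where "n = T * m"
  define \<eta> where "\<eta> = \<epsilon> / L"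
  define s where "s = 8000 * \<eta>"
  assume "\<not> \<epsilon> < SubOpt_NC L (hard_instance m T L (8000 * (\<epsilon> / L))) x"
  then have sub: "SubOpt_NC L (hard_instance m T L s) x \<le> \<epsilon>"
    by (simp add: s_def \<eta>_def)
  have \<eta>: "0 < \<eta>" and s: "0 < s"
    using assms by (simp_all add: s_def \<eta>_def)
  have m0: "0 < m" using m by simp
  define g where "g = chain_gradient m n (2 * n) L s x"
  define w where "w = x - (1 / (2 * L)) \<cdot>\<^sub>v g"
  define p where "p = kernel_proj m n w"
  define Y where "Y = block_coeff m w"
  define X where "X c = x $ c / s" for c
  have x': "x \<in> carrier_vec (2 * n)" and g: "g \<in> carrier_vec (2 * n)"
    using x by (simp_all add: n_def g_def chain_gradient_def)
  have p: "p \<in> carrier_vec (2 * n)"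
    by (simp add: p_def kernel_proj_carrier)
  have "SubOpt_NC L (hard_instance m T L s) x = L * vnorm (x - p)"
    unfolding SubOpt_hard_instance[OF m \<open>0 < L\<close> s x] p_def w_def g_def n_def ..
  then have dist: "vnorm (x - p) \<le> \<eta>"
    using sub \<open>0 < L\<close> by (simp add: \<eta>_def field_simps)
  have less: "i * m + j < n" if "i < T" "j < m" for i j
  proof -
    have "(i + 1) * m \<le> n" unfolding n_def using that(1) by (intro mult_le_mono1) simp
    then show ?thesis using that(2) by simp
  qed
  have close: "\<bar>x $ c - p $ c\<bar> \<le> \<eta>" if "c < n" for c
  proof -
    have "\<bar>(x - p) $ c\<bar> \<le> vnorm (x - p)"
      using x' p that by (intro abs_index_le_vnorm[of _ "2 * n"]) auto
    then show ?thesis using dist that p by simp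
  qed
  have start: "p $ (i * m) = Y i" if "i < T" for i
    using less[OF that m0] m0 by (simp add: p_def kernel_proj_def Y_def path_weight_def)
  have "end": "p $ (i * m + (m - 1)) = Y i" if "i < T" for i
  proof -
    have l: "i * m + (m - 1) < n" using less[OF that, of "m - 1"] m0 by simp
    have "Suc (i * m + (m - 1)) = (i + 1) * m" using m0 by simp
    then have "m dvd Suc (i * m + (m - 1))" by (metis dvd_triv_right)
    then have "path_weight m (i * m + (m - 1)) = 1"
      unfolding path_weight_def by simp
    moreover have "(i * m + (m - 1)) div m = i"
      using m0 by (intro div_block) auto
    ultimately show ?thesis
      using l unfolding p_def kernel_proj_def Y_def by simp
  qed
  have "n - 1 = (T - 1) * m + (m - 1)"
    using T m0 unfolding n_def by (cases T) simp_all
  then have "p $ (n - 1) = Y (T - 1)" "x $ (n - 1) = 0"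
    using "end"[of "T - 1"] last T by (simp_all add: n_def)
  moreover have "n - 1 < n"
    using T m0 by (simp add: n_def)
  ultimately have "\<bar>Y (T - 1)\<bar> \<le> \<eta>"
    using close[of "n - 1"] by simp
  then have Y_last: "Y (T - 1) < s / 2"
    using \<eta> by (simp add: s_def)
  \<comment> \<open>The frontier: this block is off and its predecessor is on. The slack between the
    threshold 1/2 and the bounds 1/4 and 3/4 in \<open>link_snd_le\<close> absorbs the deviation
    \<open>\<eta>\<close>, which is \<open>s / 8000\<close>.\<close>
  define i where "i = (LEAST i. Y i < s / 2)"
  have Yi: "Y i < s / 2"
    unfolding i_def by (rule LeastI[of "\<lambda>i. Y i < s / 2", OF Y_last])
  have "i \<le> T - 1"
    unfolding i_def by (rule Least_le[of "\<lambda>i. Y i < s / 2", OF Y_last])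
  then have i: "i < T" using T by simp
  have before: "s / 2 \<le> Y j" if "j < i" for j
    using not_less_Least[of j "\<lambda>i. Y i < s / 2"] that unfolding i_def by simp
  define c where "c = i * m"
  have c: "c < n" using less[OF i m0] by (simp add: c_def)
  have "X c \<le> 3 / 4"
  proof -
    have "x $ c \<le> 3 / 4 * s"
      using close[OF c] start[OF i] Yi \<eta> unfolding c_def s_def by linarith
    then show ?thesis using s by (simp add: X_def field_simps)
  qed
  moreover have "1 / 4 \<le> prev_coord X c"
  proof (cases i)
    case 0
    \<comment> \<open>At the first block the virtual predecessor has value 2.\<close>
    then show ?thesis by (simp add: prev_coord_def c_def)
  next
    case (Suc j)
    have cj: "c - 1 = j * m + (m - 1)" "c \<noteq> 0"
      using m0 by (simp_all add: c_def Suc)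
    have "p $ (c - 1) = Y j"
      unfolding cj(1) by (rule "end") (use i Suc in simp)
    moreover have "s / 2 \<le> Y j"
      by (rule before) (simp add: Suc)
    moreover have "\<bar>x $ (c - 1) - p $ (c - 1)\<bar> \<le> \<eta>"
      by (rule close) (use c in simp)
    ultimately have "1 / 4 * s \<le> x $ (c - 1)"
      using \<eta> unfolding s_def by linarith
    then show ?thesis using s cj(2) by (simp add: X_def prev_coord_def field_simps)
  qed
  ultimately have "link_snd (prev_coord X c) (X c) \<le> - 1 / 128"
    by (intro link_snd_le)
  moreover have "chain_deriv m n X c \<le> link_snd (prev_coord X c) (X c)"
    using link_fst_nonpos by (simp add: chain_deriv_def c_def)
  ultimately have "chain_deriv m n X c \<le> - 1 / 128"
    by linarith
  then have "L * s / 12 * chain_deriv m n X c \<le> L * s / 12 * (- 1 / 128)"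
    using \<open>0 < L\<close> s by (intro mult_left_mono) auto
  then have gc: "g $ c \<le> - (L * s / 1536)"
    using c unfolding g_def chain_gradient_def X_def[abs_def] by simp
  have g_nonpos: "g $ c \<le> 0" if "c < n" for c
    using that \<open>0 < L\<close> s chain_deriv_nonpos by (simp add: g_def chain_gradient_def mult_nonneg_nonpos)
  define B where "B = {i*m..<i*m+m}"
  have B: "c < n" if "c \<in> B" for c
    using that less[OF i, of "c - i * m"] by (auto simp: B_def)
  have cB: "c \<in> B" using m0 by (simp add: B_def c_def)
  \<comment> \<open>The normal equation on the frontier block; splitting \<open>w\<close> turns it
    into an identity between the weighted deviation and the weighted gradient.\<close>
  have "0 = (\<Sum>c\<in>B. path_weight m c * (w $ c - p $ c))"
    using kernel_proj_block_orthogonal[OF m0 i, of w] by (simp add: p_def n_def B_def)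
  also have "\<dots> = (\<Sum>c\<in>B. path_weight m c * (x $ c - p $ c) - 1 / (2 * L) * (path_weight m c * g $ c))"
  proof (intro sum.cong refl)
    fix b assume "b \<in> B"
    then have w: "w $ b = x $ b - 1 / (2 * L) * g $ b"
      using B[of b] x' g by (simp add: w_def)
    show "path_weight m b * (w $ b - p $ b) = path_weight m b * (x $ b - p $ b) - 1 / (2 * L) * (path_weight m b * g $ b)"
      unfolding w by (simp add: algebra_simps)
  qed
  finally have eq: "(\<Sum>c\<in>B. path_weight m c * (x $ c - p $ c)) = 1 / (2 * L) * (\<Sum>c\<in>B. path_weight m c * g $ c)"
    by (simp add: sum_subtractf sum_distrib_left)
  \<comment> \<open>All terms are nonpositive, so the frontier entry, which has weight 1, can be
    isolated.\<close>
  have "(\<Sum>c\<in>B. path_weight m c * g $ c) \<le> (\<Sum>b\<in>B. if b = c then g $ c else 0)"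
  proof (rule sum_mono)
    fix b assume "b \<in> B"
    then have "path_weight m b * g $ b \<le> 0"
      using g_nonpos[OF B] path_weight_pos[OF m0, of b] by (simp add: mult_nonneg_nonpos)
    moreover have "path_weight m c = 1" by (simp add: path_weight_def c_def)
    ultimately show "path_weight m b * g $ b \<le> (if b = c then g $ c else 0)" by auto
  qed
  also have "\<dots> = g $ c"
    using cB by (simp add: B_def)
  finally have "1 / (2 * L) * (\<Sum>c\<in>B. path_weight m c * g $ c) \<le> 1 / (2 * L) * - (L * s / 1536)"
    using gc \<open>0 < L\<close> by (intro mult_left_mono) auto
  also have "\<dots> = - (s / 3072)"
    using \<open>0 < L\<close> by simp
  finally have upper: "(\<Sum>c\<in>B. path_weight m c * (x $ c - p $ c)) \<le> - (s / 3072)"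
    using eq by simp
  \<comment> \<open>Young's inequality; the sums 3 and \<open>\<eta>\<^sup>2\<close> of the two
    squares then give \<open>2 * \<eta>\<close> independently of \<open>m\<close>.\<close>
  have "- (path_weight m c * (x $ c - p $ c)) \<le> \<eta> / 2 * (path_weight m c)\<^sup>2 + 1 / (2 * \<eta>) * (x $ c - p $ c)\<^sup>2" for c
  proof -
    have "0 \<le> (\<eta> * path_weight m c + (x $ c - p $ c))\<^sup>2 / (2 * \<eta>)"
      using \<eta> by simp
    also have "\<dots> = \<eta> / 2 * (path_weight m c)\<^sup>2 + 1 / (2 * \<eta>) * (x $ c - p $ c)\<^sup>2 + path_weight m c * (x $ c - p $ c)"
      using \<eta> by (simp add: power2_eq_square field_simps)
    finally show ?thesis by linarith
  qed
  then have "(\<Sum>c\<in>B. - (path_weight m c * (x $ c - p $ c)))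
      \<le> (\<Sum>c\<in>B. \<eta> / 2 * (path_weight m c)\<^sup>2 + 1 / (2 * \<eta>) * (x $ c - p $ c)\<^sup>2)"
    by (intro sum_mono)
  also have "\<dots> = \<eta> / 2 * (\<Sum>c\<in>B. (path_weight m c)\<^sup>2) + 1 / (2 * \<eta>) * (\<Sum>c\<in>B. (x $ c - p $ c)\<^sup>2)"
    by (simp only: sum.distrib sum_distrib_left)
  also have "\<dots> \<le> \<eta> / 2 * 3 + 1 / (2 * \<eta>) * \<eta>\<^sup>2"
  proof (intro add_mono mult_left_mono)
    show "(\<Sum>c\<in>B. (path_weight m c)\<^sup>2) \<le> 3"
      unfolding B_def by (rule sum_path_weight_sq_le[OF m0])
    have "(\<Sum>c\<in>B. (x $ c - p $ c)\<^sup>2) \<le> (\<Sum>c<2 * n. ((x - p) $ c)\<^sup>2)"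
    proof -
      have "(\<Sum>c\<in>B. (x $ c - p $ c)\<^sup>2) = (\<Sum>c\<in>B. ((x - p) $ c)\<^sup>2)"
      proof (intro sum.cong refl)
        fix b assume "b \<in> B"
        then show "(x $ b - p $ b)\<^sup>2 = ((x - p) $ b)\<^sup>2"
          using B[of b] x' p by simp
      qed
      also have "\<dots> \<le> (\<Sum>c<2 * n. ((x - p) $ c)\<^sup>2)"
        using B by (intro sum_mono2) force+
      finally show ?thesis .
    qed
    also have "\<dots> = (vnorm (x - p))\<^sup>2"
      using x' p by (intro vnorm_sq[symmetric]) auto
    also have "\<dots> \<le> \<eta>\<^sup>2"
      using dist vnorm_nonneg by (intro power_mono)
    finally show "(\<Sum>c\<in>B. (x $ c - p $ c)\<^sup>2) \<le> \<eta>\<^sup>2" .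
  qed (use \<eta> in simp_all)
  also have "\<dots> = 2 * \<eta>"
    using \<eta> by (simp add: power2_eq_square)
  finally have "- (\<Sum>c\<in>B. path_weight m c * (x $ c - p $ c)) \<le> 2 * \<eta>"
    by (simp only: sum_negf)
  \<comment> \<open>This would need \<open>s \<le> 6144 * \<eta>\<close>; the scale 8000 was chosen
    to exceed that.\<close>
  with upper have "s / 3072 \<le> 2 * \<eta>" by linarith
  then show False using \<eta> by (simp add: s_def)
qed

theorem corollary8:
  shows "\<exists>c\<^sub>0 C :: real. 0 < c\<^sub>0 \<and> 0 < C \<and>
    (\<forall>L\<^sub>f \<Delta> \<kappa>\<^sub>A \<epsilon> :: real. \<forall>alg :: algorithm.
       0 < L\<^sub>f \<and> 0 < \<Delta> \<and> 1 \<le> \<kappa>\<^sub>A \<and> first_order_linear_span alg \<and>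
       0 < \<epsilon> \<and> \<epsilon> \<le> c\<^sub>0 * sqrt (L\<^sub>f * \<Delta>) \<longrightarrow>
       (\<exists>P \<in> F_NC L\<^sub>f \<Delta> \<kappa>\<^sub>A. \<forall>k.
          SubOpt_NC L\<^sub>f P (fst (alg P k)) \<le> \<epsilon> \<longrightarrow>
          C * (\<kappa>\<^sub>A * L\<^sub>f * \<Delta> / \<epsilon>\<^sup>2) \<le> real k))"
\<comment> \<open>The first constant makes \<open>Q\<close> at least 3, so rounding down keeps half
  of it. The second is the factor 12/64000000 of \<open>Q\<close> divided by 16: a loss of 2 from
  rounding \<open>T\<close> and of 8 from \<open>m \<ge> \<kappa> / 8\<close>.\<close>
proof (rule exI[of _ "1 / 4000"], rule exI[of _ "12 / 1024000000"], intro conjI allI impI)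
  fix L \<Delta> \<kappa> \<epsilon> :: real and alg :: algorithm
  assume "0 < L \<and> 0 < \<Delta> \<and> 1 \<le> \<kappa> \<and> first_order_linear_span alg \<and>
    0 < \<epsilon> \<and> \<epsilon> \<le> 1 / 4000 * sqrt (L * \<Delta>)"
  then have L: "0 < L" and \<Delta>: "0 < \<Delta>" and \<kappa>: "1 \<le> \<kappa>" and alg: "first_order_linear_span alg"
    and \<epsilon>: "0 < \<epsilon>" "\<epsilon> \<le> 1 / 4000 * sqrt (L * \<Delta>)"
    by auto
  \<comment> \<open>The number of links that would use up the gap \<open>\<Delta>\<close> exactly,
    at cost \<open>L * s\<^sup>2 / 12\<close> each.\<close>
  define Q where "Q = 12 / 64000000 * (L * \<Delta> / \<epsilon>\<^sup>2)"
  define T where "T = nat \<lfloor>Q\<rfloor>"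
  \<comment> \<open>Below 12 the orthonormal case \<open>m = 2\<close> is admissible for every
    \<open>\<kappa> \<ge> 1\<close> and costs only a constant.\<close>
  define m where "m = (if \<kappa> < 12 then 2 else nat \<lfloor>\<kappa> / 4\<rfloor>)"
  define s where "s = 8000 * (\<epsilon> / L)"
  have "\<epsilon>\<^sup>2 \<le> (1 / 4000 * sqrt (L * \<Delta>))\<^sup>2"
    using \<epsilon> by (intro power_mono) auto
  also have "\<dots> = L * \<Delta> / 16000000"
    using L \<Delta> by (simp add: power_mult_distrib power_divide)
  finally have "16000000 \<le> L * \<Delta> / \<epsilon>\<^sup>2"
    using \<epsilon>(1) by (simp add: field_simps)
  then have Q: "3 \<le> Q" by (simp add: Q_def)
  have T: "Q / 2 \<le> real T" "real T \<le> Q" "0 < T"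
    using Q unfolding T_def by linarith+
  have m: "2 \<le> m" "m = 2 \<or> 4 * real m \<le> \<kappa>" "\<kappa> / 8 \<le> real m"
    using \<kappa> unfolding m_def by (auto simp: le_nat_iff) linarith+
  have s: "0 < s" using L \<epsilon> by (simp add: s_def)
  have "real T * (L * s\<^sup>2 / 12) \<le> Q * (L * s\<^sup>2 / 12)"
    using T(2) L by (intro mult_right_mono) auto
  also have "\<dots> = \<Delta>"
    using L \<epsilon>(1) by (simp add: Q_def s_def power2_eq_square)
  finally have gap: "real T * (L * s\<^sup>2 / 12) \<le> \<Delta>" .
  let ?P = "hard_instance m T L s"
  note P = hard_instance_in_class[OF m(1,2) \<kappa> T(3) L s gap]
  have run: "equality_span_run ?P (\<lambda>k. fst (alg ?P k))"
    using alg P(1) linear_equality_hard_instance unfolding first_order_linear_span_def by metis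
  show "\<exists>P \<in> F_NC L \<Delta> \<kappa>. \<forall>k. SubOpt_NC L P (fst (alg P k)) \<le> \<epsilon> \<longrightarrow>
      12 / 1024000000 * (\<kappa> * L * \<Delta> / \<epsilon>\<^sup>2) \<le> real k"
  proof (intro bexI[of _ ?P] allI impI)
    fix k assume sub: "SubOpt_NC L ?P (fst (alg ?P k)) \<le> \<epsilon>"
    \<comment> \<open>Before iteration \<open>T * m\<close> the last chain coordinate,
      \<open>T * m - 1\<close>, is still zero, so the measure exceeds \<epsilon>.\<close>
    have "T * m \<le> k"
    proof (rule ccontr)
      assume "\<not> T * m \<le> k"
      then have "fst (alg ?P k) $ (T * m - 1) = 0"
        using T(3) m(1) by (intro equality_span_run_support(2)[OF run L s]) auto
      then have "\<epsilon> < SubOpt_NC L ?P (fst (alg ?P k))"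
        unfolding s_def using equality_span_run_support(1)[OF run L s, of k] m(1) T(3) L \<epsilon>(1)
        by (intro SubOpt_hard_instance_gt) (simp_all add: s_def)
      with sub show False by simp
    qed
    then have "real T * real m \<le> real k"
      unfolding of_nat_mult[symmetric] of_nat_le_iff .
    moreover have "Q / 2 * (\<kappa> / 8) \<le> real T * real m"
      using T m(3) \<kappa> Q by (intro mult_mono) auto
    moreover have "Q / 2 * (\<kappa> / 8) = 12 / 1024000000 * (\<kappa> * L * \<Delta> / \<epsilon>\<^sup>2)"
      by (simp add: Q_def)
    ultimately show "12 / 1024000000 * (\<kappa> * L * \<Delta> / \<epsilon>\<^sup>2) \<le> real k"
      by linarith
  qed (fact P(2))
qed simp_all

end
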